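(* Assume that the following conjecture is true: for all $0\le\beta\le\tfrac12$, all $M\in\mathbb N$ and all $x\in[0,1]$, $K^{\beta}_M(x)\ge 0$. Let $a_m\ge 0$ ($m\in\mathbb N$) be a sequence such that $a_m\to 0$ as $m\to\infty$, and fix $0\le\alpha<\tfrac12$. Then there is a function $f$ such that $\sqrt{x}\,f(x)\in L^1([0,1])$, whose Bessel--Fourier coefficients of order zero, $f_m$, satisfy $$0\le a_m\le\frac{f_m}{j_m^{\alpha}}\quad\text{for all } m\in\mathbb N,\qquad\text{and}\qquad \frac{f_m}{j_m^{\alpha}}\to 0\ \text{ as } m\to\infty.$$ Furthermore, $f$ can be chosen so that $f_{2m}=0$ for all $m\in\mathbb N$, or so that $f_{2m+1}=0$ for all $m\in\mathbb N$.
   Context: $\mathbb N$ is the set of positive integers. $J_0$ and $J_1$ denote the Bessel functions of the first kind of orders $0$ and $1$. For $m\in\mathbb N$, $j_m>0$ denotes the $m$-th positive zero of $J_0$ (in increasing order). $L^1([0,1])$ is taken with respect to Lebesgue measure $dx$. The Bessel--Fourier coefficients of order zero of a function $f$ on $[0,1]$ are $$f_m:=\frac{2}{J_1(j_m)^2}\int_0^1 f(x)J_0(j_mx)\,x\,dx,\qquad m\in\mathbb N.$$ For real $\beta$ and $M\in\mathbb N$, the modified Fejér kernel is $$K^{\beta}_M(x):=\sum_{m=1}^{M}\left(1-\frac{m}{M+1}\right)j_m^{\beta}J_0(j_mx).$$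
   Formalization: In the "Furthermore" part, a_m ≤ f_m/j_m^α is claimed only for indices m whose coefficient is not prescribed to vanish (odd m; resp. m = 1 and even m), since the bound for all m is impossible if, e.g., a_m = 1/m and f_{2m} = 0. *)

theory Defs
  imports "HOL-Analysis.Analysis"
begin

definition bessel_J :: "nat \<Rightarrow> real \<Rightarrow> real" where
  "bessel_J n x = (\<Sum>k. (-1) ^ k / (fact k * fact (k + n)) * (x / 2) ^ (2 * k + n))"

text \<open>
  The \<open>m\<close>-th positive zero of \<open>J\<^sub>0\<close> is the zero \<open>z > 0\<close> such that \<open>(0, z]\<close> contains exactly
  \<open>m\<close> zeros. The right endpoint is included because then \<open>m \<ge> 1\<close> rules out the convention
  \<open>card A = 0\<close> for infinite \<open>A\<close>. The value at \<open>m = 0\<close> is meaningless.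
\<close>
definition bessel_J0_zero :: "nat \<Rightarrow> real" where
  "bessel_J0_zero m =
     (THE z. z > 0 \<and> bessel_J 0 z = 0 \<and> card {y \<in> {0<..z}. bessel_J 0 y = 0} = m)"

definition bessel_fourier_coeff :: "(real \<Rightarrow> real) \<Rightarrow> nat \<Rightarrow> real" where
  "bessel_fourier_coeff f m =
     2 / (bessel_J 1 (bessel_J0_zero m))\<^sup>2 *
     (LINT x:{0..1}|lebesgue. f x * bessel_J 0 (bessel_J0_zero m * x) * x)"

definition modified_fejer_kernel :: "real \<Rightarrow> nat \<Rightarrow> real \<Rightarrow> real" where
  "modified_fejer_kernel \<beta> M x =
     (\<Sum>m=1..M. (1 - real m / (real M + 1)) * bessel_J0_zero m powr \<beta> *
        bessel_J 0 (bessel_J0_zero m * x))"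

end

theory Submission
  imports Defs
begin

text \<open>
  The function is a superposition $f = \sum_k w_k D_{N_k}$ of partial sums $D_N(x) = \sum_{m
  \le N,\, m \in P} j_m^\alpha J_0(j_m x)$, where $P$ is the set of indices whose
  coefficients may be nonzero. By orthogonality the coefficients of $D_N$ are $j_m^\alpha$
  for $m \in P$ with $m \le N$ and zero otherwise, so that $f_m / j_m^\alpha = \sum_{k : m
  \le N_k} w_k$ for $m \in P$. Every null sequence lies below such a step sequence with
  summable weights $w_k \ge 0$ (null_sequence_step_majorant), and the step sequence itself
  tends to zero.

  What has to be shown is that the series converges in the weighted space and may be
  integrated term by term. This holds because the single kernels $D_N$ have a common
  integrable majorant: $\sqrt x\, |D_N(x)| \le C\, (x (1 - x))^{-\theta}$ on $[0, 1]$, with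
  $C$ independent of $N$, for every $\theta < 1$ with $\theta > \alpha + 1/2$. Such a
  $\theta$ exists exactly because $\alpha < 1/2$.

  For the majorant, let $u(t) = \sqrt t\, J_0(t)$, which solves $u'' = -(1 + 1/(4 t^2)) u$.
  Then $u(t) = A \cos t + B \sin t + O(t^{-\theta})$ (bessel_u_asymptotics), so up to an
  error of size $x^{-\theta}$ the function $\sqrt x\, D_N(x)$ is a combination of the real
  and imaginary parts of $\sum_m j_m^{\alpha - 1/2} e^{i j_m x}$. Sturm comparison shows
  $|j_{m+1} - j_m - \pi| \le 1 / j_m^2$ (bessel_J0_zero_gap); along a progression of step
  two the frequencies therefore increase by nearly $2 \pi$, the exponential sums behave like
  geometric sums of ratio $e^{2 \pi i x}$ and are bounded by $C / (x (1 - x))$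
  (exp_sum_bound). Partial summation against the decreasing coefficients $j_m^{\alpha -
  1/2}$ then gives the majorant (weighted_exp_sum_bound). The step two is what allows the
  odd and the even indices to be treated separately; the set of all indices is their union.
\<close>

(* Keeps the order of bessel_J 1 from being rewritten to a successor. *)
declare One_nat_def [simp del]

section \<open>Bessel functions of orders 0 and 1\<close>

lemma fact_add_1: "fact (k + 1) = (1 + of_nat k) * (fact k :: 'a::semiring_char_0)"
  by (simp flip: Suc_eq_plus1)

text \<open>
  $J_0(x) = \varphi(x^2/4)$ and $J_1(x) = (x/2)\, \psi(x^2/4)$ with entire functions
  $\varphi$ and $\psi$. In these terms the two differentiation formulas for Bessel functions
  become $\varphi' = -\psi$ and $(y \psi)' = \varphi$, which can be read off from the
  coefficients.
\<close>
definition entire_phi :: "real \<Rightarrow> real" where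
  "entire_phi y = (\<Sum>k. (-1) ^ k / (fact k * fact k) * y ^ k)"

definition entire_psi :: "real \<Rightarrow> real" where
  "entire_psi y = (\<Sum>k. (-1) ^ k / (fact k * fact (k + 1)) * y ^ k)"

lemma summable_bessel_series:
  "summable (\<lambda>k. (-1) ^ k / (fact k * fact (k + n)) * (y::real) ^ k)"
proof (rule summable_comparison_test)
  have "norm ((-1) ^ k / (fact k * fact (k + n)) * y ^ k) \<le> inverse (fact k) * \<bar>y\<bar> ^ k" for k
  proof -
    show ?thesis
      using mult_left_mono[OF fact_ge_1, of "\<bar>y\<bar> ^ k" "k + n"]
      by (simp add: abs_mult power_abs divide_simps)
  qed
  then show "\<exists>N. \<forall>k\<ge>N. norm ((-1) ^ k / (fact k * fact (k + n)) * y ^ k) \<le> inverse (fact k) * \<bar>y\<bar> ^ k"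
    by blast
  show "summable (\<lambda>k. inverse (fact k) * \<bar>y\<bar> ^ k)"
    by (rule summable_exp)
qed

lemma bessel_J0_eq: "bessel_J 0 x = entire_phi (x\<^sup>2 / 4)"
  unfolding bessel_J_def entire_phi_def
  by (intro suminf_cong) (simp add: power_mult power_divide)

lemma bessel_J1_eq: "bessel_J 1 x = x / 2 * entire_psi (x\<^sup>2 / 4)"
proof -
  have "bessel_J 1 x = (\<Sum>k. x / 2 * ((-1) ^ k / (fact k * fact (k + 1)) * (x\<^sup>2 / 4) ^ k))"
    unfolding bessel_J_def
    by (intro suminf_cong) (simp add: power_mult power_divide power_add, simp only: mult_ac)
  also have "\<dots> = x / 2 * entire_psi (x\<^sup>2 / 4)"
    unfolding entire_psi_def by (rule suminf_mult[OF summable_bessel_series])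
  finally show ?thesis .
qed

lemma DERIV_entire_phi: "DERIV entire_phi y :> - entire_psi y"
proof -
  let ?c = "\<lambda>k. (-1) ^ k / (fact k * fact k) :: real"
  have "DERIV (\<lambda>x. \<Sum>k. ?c k * x ^ k) y :> (\<Sum>k. diffs ?c k * y ^ k)"
    by (rule termdiffs_strong_converges_everywhere) (use summable_bessel_series[of 0] in simp)
  moreover have "(\<Sum>k. diffs ?c k * y ^ k) = (\<Sum>k. - ((-1) ^ k / (fact k * fact (k + 1)) * y ^ k))"
  proof (intro suminf_cong)
    fix k
    have "diffs ?c k = - ((-1) ^ k / (fact k * fact (k + 1)))"
      by (simp add: diffs_def divide_simps fact_add_1)
    then show "diffs ?c k * y ^ k = - ((-1) ^ k / (fact k * fact (k + 1)) * y ^ k)" by simp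
  qed
  moreover have "\<dots> = - entire_psi y"
    unfolding entire_psi_def using summable_bessel_series[of 1 y] by (rule suminf_minus)
  moreover have "(\<lambda>x. \<Sum>k. ?c k * x ^ k) = entire_phi"
    by (simp add: entire_phi_def fun_eq_iff)
  ultimately show ?thesis by simp
qed

lemma DERIV_mult_entire_psi: "DERIV (\<lambda>y. y * entire_psi y) y :> entire_phi y"
proof -
  let ?b = "\<lambda>k. (-1) ^ k / (fact k * fact (k + 1)) :: real"
  \<comment> \<open>The coefficients of \<open>y \<psi>(y)\<close>.\<close>
  define d where "d = (\<lambda>k. case k of 0 \<Rightarrow> 0 | Suc i \<Rightarrow> ?b i)"
  have shift: "(\<lambda>k. d k * x ^ k) sums (x * entire_psi x)" for x
  proof -
    have "(\<lambda>k. ?b k * x ^ k) sums entire_psi x"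
      unfolding entire_psi_def using summable_bessel_series[of 1 x] by (simp add: summable_sums)
    from sums_mult[OF this, of x] have "(\<lambda>k. d (Suc k) * x ^ Suc k) sums (x * entire_psi x)"
      by (simp add: d_def mult_ac)
    from sums_Suc[OF this] show ?thesis by (simp add: d_def)
  qed
  have "DERIV (\<lambda>x. \<Sum>k. d k * x ^ k) y :> (\<Sum>k. diffs d k * y ^ k)"
    by (rule termdiffs_strong_converges_everywhere) (use shift sums_summable in blast)
  moreover have "(\<Sum>k. diffs d k * y ^ k) = entire_phi y"
    unfolding entire_phi_def
    by (intro suminf_cong) (simp add: diffs_def d_def divide_simps fact_add_1)
  moreover have "(\<lambda>x. \<Sum>k. d k * x ^ k) = (\<lambda>y. y * entire_psi y)"
    using shift sums_unique by (metis (no_types))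
  ultimately show ?thesis by simp
qed

lemma DERIV_bessel_J0 [derivative_intros]:
  "(f has_real_derivative f') (at x within S) \<Longrightarrow>
   ((\<lambda>x. bessel_J 0 (f x)) has_real_derivative - bessel_J 1 (f x) * f') (at x within S)"
proof -
  have "DERIV (\<lambda>x. entire_phi (x\<^sup>2 / 4)) t :> - bessel_J 1 t" for t
    by (rule DERIV_cong, rule DERIV_chain2[OF DERIV_entire_phi])
       (auto intro!: derivative_eq_intros simp: bessel_J1_eq)
  then have "DERIV (bessel_J 0) t :> - bessel_J 1 t" for t
    by (simp add: bessel_J0_eq[abs_def])
  then show "(f has_real_derivative f') (at x within S) \<Longrightarrow> ?thesis" by (rule DERIV_chain2)
qed

text \<open>
  Unlike the formula for $J_1'$, this one has no exceptional point at the origin, which is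
  why the integrals over $[0, 1]$ below are expressed through $t J_1(t)$.
\<close>
lemma DERIV_mult_bessel_J1: "DERIV (\<lambda>x. x * bessel_J 1 x) x :> x * bessel_J 0 x"
proof -
  have "(\<lambda>x. x * bessel_J 1 x) = (\<lambda>x. 2 * (x\<^sup>2 / 4 * entire_psi (x\<^sup>2 / 4)))"
    by (auto simp: bessel_J1_eq fun_eq_iff power2_eq_square)
  moreover have "DERIV (\<lambda>x. 2 * (x\<^sup>2 / 4 * entire_psi (x\<^sup>2 / 4))) x :> x * bessel_J 0 x"
    by (rule DERIV_cong, rule DERIV_cmult, rule DERIV_chain2[OF DERIV_mult_entire_psi])
       (auto intro!: derivative_eq_intros simp: bessel_J0_eq)
  ultimately show ?thesis by simp
qed

lemma bessel_J0_0 [simp]: "bessel_J 0 0 = 1"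
  using powser_zero[of "\<lambda>k. (-1) ^ k / (fact k * fact k) :: real"]
  by (simp add: bessel_J0_eq entire_phi_def)

lemma DERIV_bessel_J1 [derivative_intros]:
  assumes f: "(f has_real_derivative f') (at x within S)" and nz: "f x \<noteq> 0"
  shows "((\<lambda>x. bessel_J 1 (f x)) has_real_derivative
           (bessel_J 0 (f x) - bessel_J 1 (f x) / f x) * f') (at x within S)"
proof -
  have "DERIV (\<lambda>t. (t * bessel_J 1 t) / t) (f x) :> bessel_J 0 (f x) - bessel_J 1 (f x) / f x"
    by (rule DERIV_cong, rule DERIV_divide[OF DERIV_mult_bessel_J1 DERIV_ident nz])
       (use nz in \<open>simp add: field_simps\<close>)
  then have "DERIV (bessel_J 1) (f x) :> bessel_J 0 (f x) - bessel_J 1 (f x) / f x"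
    by (rule has_field_derivative_transform_within_open[of _ _ _ "- {0}"]) (use nz in auto)
  from DERIV_chain2[OF this f] show ?thesis .
qed

lemma continuous_on_bessel_J0 [continuous_intros]:
  "continuous_on S f \<Longrightarrow> continuous_on S (\<lambda>x. bessel_J 0 (f x))"
  by (rule continuous_on_compose2[of UNIV "bessel_J 0" S f])
     (auto intro!: DERIV_continuous_on DERIV_bessel_J0 DERIV_ident)

lemma bessel_J0_positive_near_0: "\<exists>\<delta>>0. \<forall>t\<in>{0..\<delta>}. 0 < bessel_J 0 t"
proof -
  have "isCont (bessel_J 0) 0"
    by (rule DERIV_isCont[OF DERIV_bessel_J0[OF DERIV_ident]])
  then have "\<forall>\<^sub>F t in at 0. bessel_J 0 t > 0"
    by (intro order_tendstoD[of _ "bessel_J 0 0"]) (auto simp: isCont_def)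
  then obtain \<delta> where \<delta>: "\<delta> > 0" "\<And>t. t \<noteq> 0 \<Longrightarrow> \<bar>t\<bar> < \<delta> \<Longrightarrow> bessel_J 0 t > 0"
    by (auto simp: eventually_at dist_real_def)
  have "0 < bessel_J 0 t" if "t \<in> {0..\<delta>/2}" for t
    using \<delta>(2)[of t] \<delta>(1) that by (cases "t = 0") auto
  then show ?thesis using \<delta>(1) by (intro exI[of _ "\<delta>/2"]) auto
qed

lemma DERIV_bessel_energy:
  assumes "t \<noteq> 0"
  shows "DERIV (\<lambda>t. t\<^sup>2 / 2 * ((bessel_J 0 t)\<^sup>2 + (bessel_J 1 t)\<^sup>2)) t :> t * (bessel_J 0 t)\<^sup>2"
  using assms by (auto intro!: derivative_eq_intros simp: power2_eq_square field_simps)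

text \<open>
  The zeros of $J_0$ are simple: the nondecreasing function $\frac{t^2}{2} (J_0^2 + J_1^2)$
  is positive near the origin, so it cannot vanish at $z$.
\<close>
lemma bessel_J1_nonzero_at_zero:
  assumes "z > 0" "bessel_J 0 z = 0"
  shows "bessel_J 1 z \<noteq> 0"
proof
  assume J1: "bessel_J 1 z = 0"
  let ?G = "\<lambda>t. t\<^sup>2 / 2 * ((bessel_J 0 t)\<^sup>2 + (bessel_J 1 t)\<^sup>2)"
  obtain \<delta> where \<delta>: "\<delta> > 0" "\<And>t. t \<in> {0..\<delta>} \<Longrightarrow> 0 < bessel_J 0 t"
    using bessel_J0_positive_near_0 by blast
  define s where "s = min z \<delta>"
  have s: "0 < s" "s \<le> z" "s \<le> \<delta>" using \<open>z > 0\<close> \<delta> by (auto simp: s_def)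
  have "?G s \<le> ?G z"
  proof (rule DERIV_nonneg_imp_nondecreasing[OF s(2)])
    fix x assume x: "s \<le> x"
    then have "x \<noteq> 0" "0 \<le> x * (bessel_J 0 x)\<^sup>2" using s by auto
    then show "\<exists>y. DERIV ?G x :> y \<and> y \<ge> 0"
      using DERIV_bessel_energy by blast
  qed
  also have "\<dots> = 0" using assms J1 by simp
  finally have "?G s \<le> 0" .
  moreover have "bessel_J 0 s > 0" using \<delta>(2)[of s] s by simp
  then have "?G s > 0" using s by (intro mult_pos_pos add_pos_nonneg) auto
  ultimately show False by simp
qed

section \<open>Sturm comparison for the Bessel equation\<close>

lemma continuous_on_DERIV:
  assumes "\<And>t. t \<in> S \<Longrightarrow> DERIV f t :> f' t"
  shows "continuous_on S f"
  by (intro continuous_at_imp_continuous_on ballI) (use assms DERIV_isCont in blast)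

text \<open>
  Comparison with $v(t) = \sin (t - T)$: the Wronskian $u v' - u' v$ has derivative $(q - 1)
  u v \ge 0$ on the half period, but decreases by $u(T) + u(T + \pi) > 0$.
\<close>
lemma sturm_no_positive_half_period:
  fixes u u' q :: "real \<Rightarrow> real"
  assumes u: "\<And>t. t \<in> {T..T+pi} \<Longrightarrow> DERIV u t :> u' t"
    and u': "\<And>t. t \<in> {T..T+pi} \<Longrightarrow> DERIV u' t :> - q t * u t"
    and q: "\<And>t. t \<in> {T..T+pi} \<Longrightarrow> 1 \<le> q t"
    and pos: "\<And>t. t \<in> {T<..T+pi} \<Longrightarrow> 0 < u t"
  shows False
proof -
  have "continuous_on {T..T+pi} u"
    using u by (rule continuous_on_DERIV)
  then have "\<forall>t\<in>{T..T+pi}. 0 \<le> u t"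
    using continuous_ge_on_closure[of "{T<..<T+pi}" u _ 0] pos
    by (auto simp: less_imp_le)
  define W where "W = (\<lambda>t. u t * cos (t - T) - u' t * sin (t - T))"
  have "W T \<le> W (T + pi)"
  proof (rule DERIV_nonneg_imp_nondecreasing[where f = W and a = T and b = "T + pi"])
    fix t assume t: "T \<le> t" "t \<le> T + pi"
    have "DERIV W t :> (q t - 1) * u t * sin (t - T)"
      unfolding W_def using t
      by (auto intro!: derivative_eq_intros u u' simp: algebra_simps)
    moreover have "0 \<le> (q t - 1) * u t * sin (t - T)"
      using q[of t] t \<open>\<forall>t\<in>{T..T+pi}. 0 \<le> u t\<close> by (intro mult_nonneg_nonneg sin_ge_zero) auto
    ultimately show "\<exists>y. DERIV W t :> y \<and> y \<ge> 0" by blast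
  qed simp
  then have "u T + u (T + pi) \<le> 0" by (simp add: W_def)
  moreover have "0 \<le> u T" using \<open>\<forall>t\<in>{T..T+pi}. 0 \<le> u t\<close> by simp
  moreover have "0 < u (T + pi)" using pos by simp
  ultimately show False by simp
qed

lemma sturm_zero_in_half_period:
  fixes u u' q :: "real \<Rightarrow> real"
  assumes u: "\<And>t. t \<in> {T..T+pi} \<Longrightarrow> DERIV u t :> u' t"
    and u': "\<And>t. t \<in> {T..T+pi} \<Longrightarrow> DERIV u' t :> - q t * u t"
    and q: "\<And>t. t \<in> {T..T+pi} \<Longrightarrow> 1 \<le> q t"
  shows "\<exists>t\<in>{T<..T+pi}. u t = 0"
proof (rule ccontr)
  assume nz: "\<not> ?thesis"
  have cont: "continuous_on {T<..T+pi} u"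
    by (rule continuous_on_subset[of "{T..T+pi}"]) (use continuous_on_DERIV[of "{T..T+pi}", OF u] in auto)
  have "connected (u ` {T<..T+pi})"
    using cont by (rule connected_continuous_image) simp
  moreover have "0 \<notin> u ` {T<..T+pi}" using nz by auto
  ultimately have no_change: "\<not> (u s \<le> 0 \<and> 0 \<le> u t)" if "s \<in> {T<..T+pi}" "t \<in> {T<..T+pi}" for s t
    using that unfolding connected_iff_interval by blast
  have "T + pi \<in> {T<..T+pi}" by simp
  from no_change[OF this] no_change[OF _ this]
  consider "\<forall>t\<in>{T<..T+pi}. 0 < u t" | "\<forall>t\<in>{T<..T+pi}. 0 < - u t"
    by (cases "0 \<le> u (T + pi)") (auto simp: not_le)
  then show False
  proof cases
    case 1
    then show ?thesis using sturm_no_positive_half_period[OF u u' q] by blast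
  next
    case 2
    have "DERIV (\<lambda>t. - u t) t :> - u' t" "DERIV (\<lambda>t. - u' t) t :> - q t * - u t"
      if "t \<in> {T..T+pi}" for t
      using DERIV_minus[OF u[OF that]] DERIV_minus[OF u'[OF that]] by simp_all
    with 2 show ?thesis
      using sturm_no_positive_half_period[of T "\<lambda>t. - u t" "\<lambda>t. - u' t" q, OF _ _ q] by blast
  qed
qed

text \<open>
  Picone's identity. With $v = \cos \varphi$ positive on $[z, z']$ and $v'' = -\omega^2 v$,
  the function $P = u u' - u^2 v'/v$ satisfies $P' = (u' - u v'/v)^2 + (\omega^2 - q) u^2
  \ge 0$. It vanishes at both zeros of $u$, although it is strictly increasing at $z'$. The
  argument applies to any two zeros, consecutive or not, and so yields the separation of the
  zeros before they have been enumerated.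
\<close>
lemma sturm_picone_gap:
  fixes u u' q :: "real \<Rightarrow> real"
  assumes u: "\<And>t. t \<in> {z..z'} \<Longrightarrow> DERIV u t :> u' t"
    and u': "\<And>t. t \<in> {z..z'} \<Longrightarrow> DERIV u' t :> - q t * u t"
    and q: "\<And>t. t \<in> {z..z'} \<Longrightarrow> q t \<le> \<omega>\<^sup>2"
    and "0 < \<omega>" "z < z'" "u z = 0" "u z' = 0" "u' z' \<noteq> 0"
  shows "pi / \<omega> \<le> z' - z"
proof (rule ccontr)
  assume "\<not> ?thesis"
  then have short: "\<omega> * (z' - z) < pi" using \<open>0 < \<omega>\<close> by (simp add: field_simps)
  \<comment> \<open>The phase is centred at the midpoint, so that it stays within a quarter period on both sides.\<close>
  define \<phi> where "\<phi> = (\<lambda>t. \<omega> * (t - (z + z') / 2))"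
  have cos_pos: "cos (\<phi> t) > 0" if "t \<in> {z..z'}" for t
  proof (rule cos_gt_zero_pi)
    have "\<omega> * (t - (z + z') / 2) \<le> \<omega> * ((z' - z) / 2)" "\<omega> * (- ((z' - z) / 2)) \<le> \<omega> * (t - (z + z') / 2)"
      using that \<open>0 < \<omega>\<close> by (auto intro!: mult_left_mono simp: field_simps)
    then show "- (pi / 2) < \<phi> t" "\<phi> t < pi / 2"
      using short by (auto simp: \<phi>_def)
  qed
  \<comment> \<open>This is \<open>- v' / v\<close>; it satisfies the Riccati equation \<open>r' = \<omega>\<^sup>2 + r\<^sup>2\<close>.\<close>
  define r where "r = (\<lambda>t. \<omega> * tan (\<phi> t))"
  define P where "P = (\<lambda>t. u t * u' t + (u t)\<^sup>2 * r t)"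
  define P' where "P' = (\<lambda>t. (u' t + u t * r t)\<^sup>2 + (\<omega>\<^sup>2 - q t) * (u t)\<^sup>2)"
  have P: "DERIV P t :> P' t" if t: "t \<in> {z..z'}" for t
  proof -
    have "DERIV \<phi> t :> \<omega>"
      unfolding \<phi>_def by (auto intro!: derivative_eq_intros)
    then have "DERIV r t :> \<omega> * (inverse ((cos (\<phi> t))\<^sup>2) * \<omega>)"
      unfolding r_def using cos_pos[OF t]
      by (intro DERIV_cmult DERIV_chain2[OF DERIV_tan]) auto
    also have "inverse ((cos (\<phi> t))\<^sup>2) = 1 + (tan (\<phi> t))\<^sup>2"
      using cos_pos[OF t] by (simp add: tan_sec inverse_eq_divide power_divide)
    also have "\<omega> * ((1 + (tan (\<phi> t))\<^sup>2) * \<omega>) = \<omega>\<^sup>2 + (r t)\<^sup>2"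
      by (simp add: r_def algebra_simps power2_eq_square)
    finally have r: "DERIV r t :> \<omega>\<^sup>2 + (r t)\<^sup>2" .
    show ?thesis
      unfolding P_def P'_def
      by (auto intro!: derivative_eq_intros u[OF t] u'[OF t] r simp: algebra_simps power2_eq_square)
  qed
  have nonneg: "0 \<le> P' t" if "t \<in> {z..z'}" for t
    unfolding P'_def using q[OF that] by (intro add_nonneg_nonneg mult_nonneg_nonneg) auto
  have "P' z' > 0" using \<open>u z' = 0\<close> \<open>u' z' \<noteq> 0\<close> by (simp add: P'_def)
  from DERIV_pos_inc_left[OF P this] \<open>z < z'\<close> obtain d where d: "d > 0" "\<And>h. 0 < h \<Longrightarrow> h < d \<Longrightarrow> P (z' - h) < P z'"
    by auto
  define h where "h = min (d / 2) (z' - z)"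
  have h: "0 < h" "h < d" "z \<le> z' - h" using d \<open>z < z'\<close> by (auto simp: h_def)
  have "P z \<le> P (z' - h)"
    using h(3)
  proof (rule DERIV_nonneg_imp_nondecreasing)
    fix t assume "z \<le> t" "t \<le> z' - h"
    with h have "t \<in> {z..z'}" by auto
    with P nonneg show "\<exists>y. DERIV P t :> y \<and> y \<ge> 0" by blast
  qed
  also have "\<dots> < P z'" using d h by blast
  finally show False using \<open>u z = 0\<close> \<open>u z' = 0\<close> by (simp add: P_def)
qed

text \<open>
  The Liouville normal form of the Bessel equation: the factor $\sqrt t$ removes the
  first-order term, and the same factor is the weight in the integrability condition.
\<close>
definition bessel_u :: "real \<Rightarrow> real" where
  "bessel_u t = sqrt t * bessel_J 0 t"

definition bessel_u' :: "real \<Rightarrow> real" where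
  "bessel_u' t = bessel_J 0 t / (2 * sqrt t) - sqrt t * bessel_J 1 t"

lemma DERIV_bessel_u:
  assumes "0 < t"
  shows "DERIV bessel_u t :> bessel_u' t"
  unfolding bessel_u_def[abs_def] bessel_u'_def using assms
  by (auto intro!: derivative_eq_intros simp: field_simps)

lemma DERIV_bessel_u':
  assumes "0 < t"
  shows "DERIV bessel_u' t :> - (1 + 1 / (4 * t\<^sup>2)) * bessel_u t"
proof -
  define s where "s = sqrt t"
  have s: "s > 0" "t = s * s" using assms by (auto simp: s_def)
  show ?thesis
  unfolding bessel_u_def bessel_u'_def[abs_def] 
  apply (rule derivative_eq_intros refl | use assms in force)+
    using s(1)
  by (simp add: s_def[symmetric] ) (simp add: s(2) field_simps power2_eq_square)
qed

lemma bessel_u_eq_0_iff: "0 < t \<Longrightarrow> bessel_u t = 0 \<longleftrightarrow> bessel_J 0 t = 0"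
  by (simp add: bessel_u_def)

lemma bessel_J0_zero_in_half_period:
  assumes "0 < T"
  shows "\<exists>z\<in>{T<..T+pi}. bessel_J 0 z = 0"
proof -
  have "\<exists>t\<in>{T<..T+pi}. bessel_u t = 0"
  proof (rule sturm_zero_in_half_period[of T _ bessel_u' "\<lambda>t. 1 + 1 / (4 * t\<^sup>2)"])
    fix t assume "t \<in> {T..T + pi}"
    then have "0 < t" using assms by auto
    then show "DERIV bessel_u t :> bessel_u' t" "DERIV bessel_u' t :> - (1 + 1 / (4 * t\<^sup>2)) * bessel_u t"
      by (rule DERIV_bessel_u, rule DERIV_bessel_u')
  qed auto
  then show ?thesis using assms by (auto simp: bessel_u_eq_0_iff)
qed

lemma bessel_J0_zeros_gap:
  assumes "0 < y" "y \<le> z" "z < z'" "bessel_J 0 z = 0" "bessel_J 0 z' = 0"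
  shows "pi / sqrt (1 + 1 / (4 * y\<^sup>2)) \<le> z' - z"
proof (rule sturm_picone_gap[of z z' bessel_u bessel_u' "\<lambda>t. 1 + 1 / (4 * t\<^sup>2)"])
  show "1 + 1 / (4 * t\<^sup>2) \<le> (sqrt (1 + 1 / (4 * y\<^sup>2)))\<^sup>2" if "t \<in> {z..z'}" for t
  proof -
    have "y\<^sup>2 \<le> t\<^sup>2" using that assms by (intro power_mono) auto
    moreover have "0 < y\<^sup>2" "0 < t\<^sup>2" using assms that by auto
    ultimately have "1 / (4 * t\<^sup>2) \<le> 1 / (4 * y\<^sup>2)" by (intro divide_left_mono) auto
    then show ?thesis by simp
  qed
  fix t assume "t \<in> {z..z'}"
  then have "0 < t" using assms by auto
  then show "DERIV bessel_u t :> bessel_u' t" "DERIV bessel_u' t :> - (1 + 1 / (4 * t\<^sup>2)) * bessel_u t"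
    by (rule DERIV_bessel_u, rule DERIV_bessel_u')
next
  show "bessel_u' z' \<noteq> 0"
    using assms bessel_J1_nonzero_at_zero[of z'] by (simp add: bessel_u'_def)
  show "0 < sqrt (1 + 1 / (4 * y\<^sup>2))" using assms by (simp add: add_pos_nonneg)
qed (use assms in \<open>auto simp: bessel_u_def\<close>)

section \<open>Zeros of the Bessel function of order 0\<close>

text \<open>
  Points at distance at least $d$ lie in different cells of a grid of mesh $d$.
\<close>
lemma finite_separated_Icc:
  fixes Z :: "real set"
  assumes "0 < d" and sep: "\<And>y z. y \<in> Z \<Longrightarrow> z \<in> Z \<Longrightarrow> y < z \<Longrightarrow> d \<le> z - y"
  shows "finite (Z \<inter> {a..b})"
proof (rule finite_imageD)
  show "finite ((\<lambda>y. \<lfloor>y / d\<rfloor>) ` (Z \<inter> {a..b}))"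
  proof (rule finite_subset)
    show "(\<lambda>y. \<lfloor>y / d\<rfloor>) ` (Z \<inter> {a..b}) \<subseteq> {\<lfloor>a / d\<rfloor>..\<lfloor>b / d\<rfloor>}"
      using \<open>0 < d\<close> by (auto intro!: floor_mono divide_right_mono)
  qed simp
  show "inj_on (\<lambda>y. \<lfloor>y / d\<rfloor>) (Z \<inter> {a..b})"
  proof (rule linorder_inj_onI')
    fix y z assume "y \<in> Z \<inter> {a..b}" "z \<in> Z \<inter> {a..b}" "y < z"
    then have "d \<le> z - y" using sep by auto
    then have "(y + d) / d \<le> z / d" using \<open>0 < d\<close> by (intro divide_right_mono) auto
    then have "y / d + 1 \<le> z / d" using \<open>0 < d\<close> by (simp add: add_divide_distrib)
    then have "\<lfloor>y / d + 1\<rfloor> \<le> \<lfloor>z / d\<rfloor>" by (rule floor_mono)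
    then show "\<lfloor>y / d\<rfloor> \<noteq> \<lfloor>z / d\<rfloor>" by linarith
  qed
qed

text \<open>
  The counting description of the $m$-th element of a discrete unbounded set is unambiguous.
  This makes the definite description in the definition of the zeros meaningful.
\<close>
lemma ex1_counted_element:
  fixes Z :: "real set"
  assumes fin: "\<And>b. finite (Z \<inter> {0<..b})" and unbounded: "\<And>T. \<exists>z\<in>Z. T < z" and "1 \<le> m"
  shows "\<exists>!z. z > 0 \<and> z \<in> Z \<and> card (Z \<inter> {0<..z}) = m"
proof -
  have less: "card (Z \<inter> {0<..y}) < card (Z \<inter> {0<..z})" if "0 < y" "y < z" "z \<in> Z" for y z
  proof (intro psubset_card_mono fin psubsetI)
    have "z \<in> Z \<inter> {0<..z}" "z \<notin> Z \<inter> {0<..y}" using that by auto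
    then show "Z \<inter> {0<..y} \<noteq> Z \<inter> {0<..z}" by blast
  qed (use that in auto)
  have "\<exists>z\<in>Z. 0 < z \<and> card (Z \<inter> {0<..z}) = Suc n" for n
  proof -
    have "\<exists>y\<ge>0. card (Z \<inter> {0<..y}) = n" for n
    proof (induction n)
      case 0
      show ?case by (intro exI[of _ 0]) auto
    next
      case (Suc n)
      then obtain y where y: "y \<ge> 0" "card (Z \<inter> {0<..y}) = n" by blast
      obtain b where b: "b \<in> Z" "y < b" using unbounded by blast
      let ?A = "Z \<inter> {y<..b}"
      have A: "finite ?A" "?A \<noteq> {}" using b y by (auto intro: finite_subset[OF _ fin[of b]])
      have "Z \<inter> {0<..Min ?A} = insert (Min ?A) (Z \<inter> {0<..y})"
      proof -
        have M: "Min ?A \<in> ?A" using A by (rule Min_in)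
        have "x \<le> y" if "x \<in> Z" "x < Min ?A" for x
        proof (rule ccontr)
          assume "\<not> x \<le> y"
          with that M have "x \<in> ?A" by auto
          then show False using Min_le[OF A(1)] that by fastforce
        qed
        then show ?thesis using M y by force
      qed
      moreover have "Min ?A \<notin> Z \<inter> {0<..y}" using Min_in[OF A] by auto
      ultimately have "card (Z \<inter> {0<..Min ?A}) = Suc n" using fin[of y] y by simp
      moreover have "0 \<le> Min ?A" using Min_in[OF A] y by auto
      ultimately show ?case by blast
    qed
    from this[of "Suc n"] obtain y where y: "card (Z \<inter> {0<..y}) = Suc n" by blast
    let ?A = "Z \<inter> {0<..y}"
    have A: "finite ?A" "?A \<noteq> {}" using y by (auto simp: fin)
    have "Z \<inter> {0<..Max ?A} = ?A"
      using Max_in[OF A] Max_ge[OF A(1)] by auto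
    with y Max_in[OF A] show ?thesis by (intro bexI[of _ "Max ?A"]) auto
  qed
  from this[of "m - 1"] \<open>1 \<le> m\<close> obtain z where "z \<in> Z" "0 < z" "card (Z \<inter> {0<..z}) = m" by auto
  then show ?thesis
  proof (intro ex1I[of _ z])
    fix y assume "y > 0 \<and> y \<in> Z \<and> card (Z \<inter> {0<..y}) = m"
    then show "y = z"
      using less[of y z] less[of z y] \<open>z \<in> Z\<close> \<open>0 < z\<close> \<open>card (Z \<inter> {0<..z}) = m\<close>
      by (cases y z rule: linorder_cases) auto
  qed auto
qed

definition bessel_J0_zeros :: "real set" where
  "bessel_J0_zeros = {z. 0 < z \<and> bessel_J 0 z = 0}"

lemma bessel_J0_zeros_separated:
  "\<exists>d>0. (\<forall>z\<in>bessel_J0_zeros. d \<le> z) \<and>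
     (\<forall>y\<in>bessel_J0_zeros. \<forall>z\<in>bessel_J0_zeros. y < z \<longrightarrow> d \<le> z - y)"
proof -
  obtain \<delta> where \<delta>: "\<delta> > 0" "\<And>t. t \<in> {0..\<delta>} \<Longrightarrow> 0 < bessel_J 0 t"
    using bessel_J0_positive_near_0 by blast
  have ge: "\<delta> \<le> z" if "z \<in> bessel_J0_zeros" for z
    using \<delta>(2)[of z] that by (force simp: bessel_J0_zeros_def)
  define e where "e = pi / sqrt (1 + 1 / (4 * \<delta>\<^sup>2))"
  have "e > 0" unfolding e_def by (intro divide_pos_pos real_sqrt_gt_zero add_pos_nonneg) auto
  moreover have "e \<le> z - y" if "y \<in> bessel_J0_zeros" "z \<in> bessel_J0_zeros" "y < z" for y z
    unfolding e_def using that ge \<delta>(1)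
    by (intro bessel_J0_zeros_gap[of \<delta> y z]) (auto simp: bessel_J0_zeros_def)
  ultimately show ?thesis
    using ge \<delta>(1) by (intro exI[of _ "min \<delta> e"]) (simp add: min_le_iff_disj)
qed

lemma finite_bessel_J0_zeros: "finite (bessel_J0_zeros \<inter> {0<..b})"
proof -
  obtain d where d: "d > 0"
    "\<And>y z. y \<in> bessel_J0_zeros \<Longrightarrow> z \<in> bessel_J0_zeros \<Longrightarrow> y < z \<Longrightarrow> d \<le> z - y"
    using bessel_J0_zeros_separated by blast
  have "finite (bessel_J0_zeros \<inter> {0..b})"
    using d by (rule finite_separated_Icc)
  then show ?thesis by (rule rev_finite_subset) auto
qed

lemma
  assumes "1 \<le> m"
  shows bessel_J0_zero_mem: "bessel_J0_zero m \<in> bessel_J0_zeros"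
    and card_bessel_J0_zeros: "card (bessel_J0_zeros \<inter> {0<..bessel_J0_zero m}) = m"
proof -
  have "\<exists>!z. z > 0 \<and> z \<in> bessel_J0_zeros \<and> card (bessel_J0_zeros \<inter> {0<..z}) = m"
  proof (rule ex1_counted_element[OF finite_bessel_J0_zeros _ assms])
    fix T :: real
    have "0 < max T 1" by simp
    from bessel_J0_zero_in_half_period[OF this]
    obtain z where "z \<in> {max T 1<..max T 1 + pi}" "bessel_J 0 z = 0" by blast
    then show "\<exists>z\<in>bessel_J0_zeros. T < z"
      by (intro bexI[of _ z]) (auto simp: bessel_J0_zeros_def)
  qed
  moreover have "bessel_J0_zeros \<inter> {0<..z} = {y \<in> {0<..z}. bessel_J 0 y = 0}" for z
    by (auto simp: bessel_J0_zeros_def)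
  ultimately have "\<exists>!z. z > 0 \<and> bessel_J 0 z = 0 \<and> card {y \<in> {0<..z}. bessel_J 0 y = 0} = m"
    by (simp add: bessel_J0_zeros_def cong: conj_cong)
  from theI'[OF this, folded bessel_J0_zero_def]
  show "bessel_J0_zero m \<in> bessel_J0_zeros" "card (bessel_J0_zeros \<inter> {0<..bessel_J0_zero m}) = m"
    by (simp_all add: bessel_J0_zeros_def Int_def conj_ac cong: conj_cong)
qed

lemma
  assumes "1 \<le> m"
  shows bessel_J0_zero_pos: "0 < bessel_J0_zero m"
    and bessel_J_0_bessel_J0_zero [simp]: "bessel_J 0 (bessel_J0_zero m) = 0"
  using bessel_J0_zero_mem[OF assms] by (auto simp: bessel_J0_zeros_def)

lemma bessel_J0_zero_strict_mono:
  assumes "1 \<le> m" "m < n"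
  shows "bessel_J0_zero m < bessel_J0_zero n"
proof (rule ccontr)
  assume "\<not> ?thesis"
  then have "card (bessel_J0_zeros \<inter> {0<..bessel_J0_zero n}) \<le> card (bessel_J0_zeros \<inter> {0<..bessel_J0_zero m})"
    by (intro card_mono finite_bessel_J0_zeros) auto
  then show False using assms by (simp add: card_bessel_J0_zeros)
qed

lemma bessel_J0_zero_inj:
  assumes "1 \<le> m" "1 \<le> n" "bessel_J0_zero m = bessel_J0_zero n"
  shows "m = n"
  using assms bessel_J0_zero_strict_mono[of m n] bessel_J0_zero_strict_mono[of n m]
  by (cases m n rule: linorder_cases) auto

text \<open>
  A zero of $J_0$ occurs within $\pi$ of $j_m$; were $j_{m+1}$ farther away, there would be
  $m + 2$ zeros up to it.
\<close>
lemma bessel_J0_zero_gap_le_pi: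
  assumes "1 \<le> m"
  shows "bessel_J0_zero (Suc m) - bessel_J0_zero m \<le> pi"
proof (rule ccontr)
  let ?a = "bessel_J0_zero m" and ?b = "bessel_J0_zero (Suc m)"
  assume "\<not> ?thesis"
  then have b: "?a + pi < ?b" by simp
  obtain z where z: "z \<in> {?a<..?a + pi}" "bessel_J 0 z = 0"
    using bessel_J0_zero_in_half_period[OF bessel_J0_zero_pos[OF assms]] by blast
  have z': "z \<in> bessel_J0_zeros" using z bessel_J0_zero_pos[OF assms] by (simp add: bessel_J0_zeros_def)
  let ?A = "bessel_J0_zeros \<inter> {0<..?a}"
  have "card (insert ?b (insert z ?A)) \<le> card (bessel_J0_zeros \<inter> {0<..?b})"
    using z z' b bessel_J0_zero_pos[OF assms] bessel_J0_zero_mem[of "Suc m"]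
    by (intro card_mono finite_bessel_J0_zeros) (auto simp: bessel_J0_zeros_def)
  moreover have "card (insert ?b (insert z ?A)) = Suc (Suc m)"
    using z b finite_bessel_J0_zeros[of ?a] pi_gt_zero
    by (simp add: card_insert_if card_bessel_J0_zeros[OF assms])
  ultimately show False by (simp add: card_bessel_J0_zeros)
qed

text \<open>
  From $\pi / \sqrt{1 + \varepsilon} \le j_{m+1} - j_m \le \pi$ with $\varepsilon = 1 / (4
  j_m^2)$. The error is summable in $m$, which is what the exponential sums need.
\<close>
lemma bessel_J0_zero_gap:
  assumes "1 \<le> m"
  shows "\<bar>bessel_J0_zero (Suc m) - bessel_J0_zero m - pi\<bar> \<le> 1 / (bessel_J0_zero m)\<^sup>2"
proof -
  let ?a = "bessel_J0_zero m" and ?b = "bessel_J0_zero (Suc m)"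
  define e where "e = 1 / (4 * ?a\<^sup>2)"
  have a: "0 < ?a" by (rule bessel_J0_zero_pos[OF assms])
  then have e: "0 < e" by (simp add: e_def)
  have "pi / sqrt (1 + e) \<le> ?b - ?a"
    unfolding e_def using assms a bessel_J0_zero_strict_mono[of m "Suc m"]
    by (intro bessel_J0_zeros_gap) auto
  moreover have "pi * (1 - e) \<le> pi / sqrt (1 + e)"
  proof -
    have "sqrt (1 + e) \<le> 1 + e" using e by (intro real_le_lsqrt) (auto simp: power2_eq_square algebra_simps)
    then have "1 / (1 + e) \<le> 1 / sqrt (1 + e)" using e by (intro divide_left_mono) auto
    moreover have "1 - e \<le> 1 / (1 + e)" using e by (simp add: field_simps)
    ultimately have "1 - e \<le> 1 / sqrt (1 + e)" by linarith
    from mult_left_mono[OF this, of pi] show ?thesis by simp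
  qed
  moreover have "pi * e \<le> 1 / ?a\<^sup>2"
    using mult_right_mono[of pi 4 "e"] pi_less_4 e a by (simp add: e_def)
  ultimately show ?thesis
    using bessel_J0_zero_gap_le_pi[OF assms] a by (simp add: algebra_simps abs_le_iff)
qed

lemma bessel_J0_zero_linear_lower_bound:
  "\<exists>d>0. \<forall>m\<ge>1. d * real m \<le> bessel_J0_zero m"
proof -
  obtain d where d: "d > 0" "\<And>z. z \<in> bessel_J0_zeros \<Longrightarrow> d \<le> z"
    "\<And>y z. y \<in> bessel_J0_zeros \<Longrightarrow> z \<in> bessel_J0_zeros \<Longrightarrow> y < z \<Longrightarrow> d \<le> z - y"
    using bessel_J0_zeros_separated by blast
  have "d * real m \<le> bessel_J0_zero m" if "1 \<le> m" for m
    using that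
  proof (induction m rule: dec_induct)
    case base
    then show ?case using d(2) bessel_J0_zero_mem by simp
  next
    case (step m)
    then have "d \<le> bessel_J0_zero (Suc m) - bessel_J0_zero m"
      by (intro d(3) bessel_J0_zero_mem bessel_J0_zero_strict_mono) auto
    with step.IH show ?case by (simp add: algebra_simps)
  qed
  then show ?thesis using d(1) by blast
qed

section \<open>Orthogonality\<close>

text \<open>
  The integrand is the derivative of $(a x J_1(a x) J_0(b x) - b x J_1(b x) J_0(a x)) / (a^2
  - b^2)$, which vanishes at both end points.
\<close>
lemma bessel_J0_orthogonality_distinct:
  assumes "bessel_J 0 a = 0" "bessel_J 0 b = 0" "a\<^sup>2 \<noteq> b\<^sup>2"
  shows "((\<lambda>x. bessel_J 0 (a * x) * bessel_J 0 (b * x) * x) has_integral 0) {0..1}"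
proof -
  define H where "H = (\<lambda>t. t * bessel_J 1 t)"
  have H: "((\<lambda>x. H (c * x)) has_real_derivative c * x * bessel_J 0 (c * x) * c) (at x within S)" for c x S
    unfolding H_def using DERIV_mult_bessel_J1
    by (rule DERIV_chain2) (auto intro!: derivative_eq_intros)
  define F where "F = (\<lambda>x. (H (a * x) * bessel_J 0 (b * x) - H (b * x) * bessel_J 0 (a * x)) / (a\<^sup>2 - b\<^sup>2))"
  have "((\<lambda>x. bessel_J 0 (a * x) * bessel_J 0 (b * x) * x) has_integral (F 1 - F 0)) {0..1}"
  proof (rule fundamental_theorem_of_calculus)
    fix x :: real
    have nz: "a\<^sup>2 - b\<^sup>2 \<noteq> 0" using assms(3) by simp
    show "(F has_vector_derivative bessel_J 0 (a * x) * bessel_J 0 (b * x) * x) (at x within {0..1})"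
      unfolding F_def has_real_derivative_iff_has_vector_derivative[symmetric]
      by (rule derivative_eq_intros refl H nz)+
         (use nz in \<open>simp add: H_def divide_simps\<close>, simp add: algebra_simps power2_eq_square)
  qed simp
  then show ?thesis using assms by (simp add: F_def H_def)
qed

text \<open>
  The integrand is the derivative of $\frac{x^2}{2} (J_0(a x)^2 + J_1(a x)^2)$.
\<close>
lemma bessel_J0_norm:
  assumes "bessel_J 0 a = 0" "a \<noteq> 0"
  shows "((\<lambda>x. bessel_J 0 (a * x) * bessel_J 0 (a * x) * x) has_integral (bessel_J 1 a)\<^sup>2 / 2) {0..1}"
proof -
  define H where "H = (\<lambda>t. t * bessel_J 1 t)"
  have H: "((\<lambda>x. H (c * x)) has_real_derivative c * x * bessel_J 0 (c * x) * c) (at x within S)" for c x S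
    unfolding H_def using DERIV_mult_bessel_J1
    by (rule DERIV_chain2) (auto intro!: derivative_eq_intros)
  define F where "F = (\<lambda>x. ((a * x)\<^sup>2 * (bessel_J 0 (a * x))\<^sup>2 + (H (a * x))\<^sup>2) / (2 * a\<^sup>2))"
  have "((\<lambda>x. bessel_J 0 (a * x) * bessel_J 0 (a * x) * x) has_integral (F 1 - F 0)) {0..1}"
  proof (rule fundamental_theorem_of_calculus)
    fix x :: real
    have nz: "2 * a\<^sup>2 \<noteq> 0" using assms(2) by simp
    show "(F has_vector_derivative bessel_J 0 (a * x) * bessel_J 0 (a * x) * x) (at x within {0..1})"
      unfolding F_def has_real_derivative_iff_has_vector_derivative[symmetric]
      by (rule derivative_eq_intros refl H nz)+
         (use assms(2) in \<open>simp add: H_def divide_simps\<close>,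
          simp add: algebra_simps power2_eq_square power4_eq_xxxx)
  qed simp
  then show ?thesis using assms by (simp add: F_def H_def power_mult_distrib)
qed

lemma bessel_J0_orthogonality:
  assumes "1 \<le> m" "1 \<le> n"
  shows "((\<lambda>x. bessel_J 0 (bessel_J0_zero m * x) * bessel_J 0 (bessel_J0_zero n * x) * x) has_integral
           (if m = n then (bessel_J 1 (bessel_J0_zero n))\<^sup>2 / 2 else 0)) {0..1}"
proof (cases "m = n")
  case True
  then show ?thesis using bessel_J0_norm[of "bessel_J0_zero n"] assms bessel_J0_zero_pos[of n] by simp
next
  case False
  then have "bessel_J0_zero m \<noteq> bessel_J0_zero n" using assms bessel_J0_zero_inj by blast
  then have "(bessel_J0_zero m)\<^sup>2 \<noteq> (bessel_J0_zero n)\<^sup>2"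
    using bessel_J0_zero_pos[OF assms(1)] bessel_J0_zero_pos[OF assms(2)] by (simp add: power2_eq_iff)
  then show ?thesis using bessel_J0_orthogonality_distinct assms False by simp
qed

section \<open>Asymptotics of the Bessel function of order 0\<close>

text \<open>
  The energy $u'^2 + (1 + 1/(4 t^2)) u^2$ is nonincreasing, because the coefficient $1 +
  1/(4 t^2)$ is; this bounds $u$ on $[1, \infty)$.
\<close>
lemma bessel_u_bounded: "\<exists>K\<ge>0. \<forall>t>0. \<bar>bessel_u t\<bar> \<le> K"
proof -
  define E where "E = (\<lambda>t. (bessel_u' t)\<^sup>2 + (1 + 1 / (4 * t\<^sup>2)) * (bessel_u t)\<^sup>2)"
  have dec: "E t \<le> E 1" if "1 \<le> t" for t
    using that
  proof (rule DERIV_nonpos_imp_nonincreasing)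
    fix x :: real assume "1 \<le> x"
    then have x: "0 < x" by simp
    have q: "DERIV (\<lambda>t. 1 + 1 / (4 * t\<^sup>2)) x :> - 1 / (2 * x ^ 3)"
      using x by (auto intro!: derivative_eq_intros simp: field_simps power2_eq_square power3_eq_cube)
    have "DERIV E x :> - (1 / (2 * x ^ 3)) * (bessel_u x)\<^sup>2"
      unfolding E_def
      by (rule derivative_eq_intros refl DERIV_bessel_u[OF x] DERIV_bessel_u'[OF x] q)+
         (simp add: algebra_simps power2_eq_square)
    moreover have "- (1 / (2 * x ^ 3)) * (bessel_u x)\<^sup>2 \<le> 0"
      using x by (simp add: mult_nonneg_nonneg)
    ultimately show "\<exists>y. DERIV E x :> y \<and> y \<le> 0" by blast
  qed
  have far: "\<bar>bessel_u t\<bar> \<le> sqrt (E 1)" if "1 \<le> t" for t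
  proof (rule real_le_rsqrt)
    have "1 * (bessel_u t)\<^sup>2 \<le> (1 + 1 / (4 * t\<^sup>2)) * (bessel_u t)\<^sup>2"
      by (intro mult_right_mono) auto
    also have "\<dots> \<le> E t" by (simp add: E_def)
    finally show "\<bar>bessel_u t\<bar>\<^sup>2 \<le> E 1" using dec[OF that] by simp
  qed
  have "continuous_on {0..1} bessel_u"
    unfolding bessel_u_def[abs_def] by (intro continuous_intros)
  then have "bounded (bessel_u ` {0..1})"
    by (intro compact_imp_bounded compact_continuous_image) auto
  then obtain K where K: "\<And>t. t \<in> {0..1} \<Longrightarrow> \<bar>bessel_u t\<bar> \<le> K"
    by (force simp: bounded_iff)
  have "\<bar>bessel_u t\<bar> \<le> max K (sqrt (E 1))" if "0 < t" for t
    using K[of t] far[of t] that by (cases "t \<le> 1") auto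
  moreover have "0 \<le> max K (sqrt (E 1))" using far[of 1] by simp
  ultimately show ?thesis by blast
qed

text \<open>
  The hypothesis makes $A(t) - K/t$ nondecreasing and $A(t) + K/t$ nonincreasing; $L$ is the
  common limit.
\<close>
lemma limit_of_inverse_square_derivative:
  fixes A A' :: "real \<Rightarrow> real"
  assumes A: "\<And>t. 1 \<le> t \<Longrightarrow> DERIV A t :> A' t"
    and bound: "\<And>t. 1 \<le> t \<Longrightarrow> \<bar>A' t\<bar> \<le> K / t\<^sup>2"
  shows "\<exists>L. \<forall>t\<ge>1. \<bar>A t - L\<bar> \<le> K / t"
proof -
  have K: "DERIV (\<lambda>t. K / t) t :> - (K / t\<^sup>2)" if "1 \<le> t" for t
    using that by (auto intro!: derivative_eq_intros simp: power2_eq_square)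
  have lo: "A s - K / s \<le> A t - K / t" if "1 \<le> s" "s \<le> t" for s t
  proof (rule DERIV_nonneg_imp_nondecreasing[where f = "\<lambda>t. A t - K / t", OF \<open>s \<le> t\<close>])
    fix x assume "s \<le> x"
    then have x: "1 \<le> x" using that by simp
    show "\<exists>y. DERIV (\<lambda>t. A t - K / t) x :> y \<and> y \<ge> 0"
      using DERIV_diff[OF A[OF x] K[OF x]] bound[OF x] by (intro exI[of _ "A' x - - (K / x\<^sup>2)"]) auto
  qed
  have hi: "A t + K / t \<le> A s + K / s" if "1 \<le> s" "s \<le> t" for s t
  proof (rule DERIV_nonpos_imp_nonincreasing[where f = "\<lambda>t. A t + K / t", OF \<open>s \<le> t\<close>])
    fix x assume "s \<le> x"
    then have x: "1 \<le> x" using that by simp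
    show "\<exists>y. DERIV (\<lambda>t. A t + K / t) x :> y \<and> y \<le> 0"
      using DERIV_add[OF A[OF x] K[OF x]] bound[OF x] by (intro exI[of _ "A' x + - (K / x\<^sup>2)"]) auto
  qed
  have "0 \<le> K" using bound[of 1] by simp
  have cross: "A s - K / s \<le> A t + K / t" if "1 \<le> s" "1 \<le> t" for s t
  proof -
    have "A s - K / s \<le> A (max s t) - K / max s t" using that by (intro lo) auto
    also have "\<dots> \<le> A (max s t) + K / max s t" using \<open>0 \<le> K\<close> that by simp
    also have "\<dots> \<le> A t + K / t" using that by (intro hi) auto
    finally show ?thesis .
  qed
  define L where "L = (SUP s\<in>{1..}. A s - K / s)"
  have "\<bar>A t - L\<bar> \<le> K / t" if t: "1 \<le> t" for t
  proof -
    have "L \<le> A t + K / t"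
      unfolding L_def using cross t by (intro cSUP_least) auto
    moreover have "A t - K / t \<le> L"
      unfolding L_def using cross[of _ 1] t by (intro cSUP_upper bdd_aboveI2[where M = "A 1 + K / 1"]) auto
    ultimately show ?thesis by linarith
  qed
  then show ?thesis by blast
qed

text \<open>
  Variation of parameters. In the frame rotating with $\cos t$, $\sin t$ the coordinates of
  $(u, u')$ have derivatives of size $|u| / (4 t^2)$, hence they converge with error
  $O(1/t)$. The bound by $K t^{-\theta}$ for all $\theta$ between 0 and 1 combines this with
  the boundedness of $u$ near the origin.
\<close>
lemma bessel_u_asymptotics:
  "\<exists>A B K. 0 \<le> K \<and> (\<forall>\<theta>\<in>{0..1}. \<forall>t>0. \<bar>bessel_u t - (A * cos t + B * sin t)\<bar> \<le> K * t powr - \<theta>)"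
proof -
  obtain K0 where K0: "0 \<le> K0" "\<And>t. 0 < t \<Longrightarrow> \<bar>bessel_u t\<bar> \<le> K0"
    using bessel_u_bounded by blast
  let ?r = "\<lambda>t. bessel_u t / (4 * t\<^sup>2)"
  have r: "\<bar>?r t * c\<bar> \<le> K0 / t\<^sup>2" if "1 \<le> t" "\<bar>c\<bar> \<le> 1" for t c
  proof -
    have "\<bar>?r t * c\<bar> \<le> \<bar>?r t\<bar> * 1"
      unfolding abs_mult using that by (intro mult_left_mono) auto
    also have "\<dots> = \<bar>bessel_u t\<bar> / (4 * t\<^sup>2)" by (simp add: abs_mult)
    also have "\<dots> \<le> K0 / t\<^sup>2"
      using that K0 K0(2)[of t] by (intro frac_le) auto
    finally show ?thesis .
  qed
  define f where "f = (\<lambda>t. bessel_u t * cos t - bessel_u' t * sin t)"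
  define g where "g = (\<lambda>t. bessel_u t * sin t + bessel_u' t * cos t)"
  have f: "DERIV f t :> ?r t * sin t" and g: "DERIV g t :> ?r t * - cos t" if "1 \<le> t" for t
  proof -
    have t: "0 < t" using that by simp
    show "DERIV f t :> ?r t * sin t" unfolding f_def
      by (rule derivative_eq_intros refl DERIV_bessel_u[OF t] DERIV_bessel_u'[OF t])+
         (simp add: algebra_simps)
    show "DERIV g t :> ?r t * - cos t" unfolding g_def
      by (rule derivative_eq_intros refl DERIV_bessel_u[OF t] DERIV_bessel_u'[OF t])+
         (simp add: algebra_simps)
  qed
  have "\<exists>A. \<forall>t\<ge>1. \<bar>f t - A\<bar> \<le> K0 / t"
    by (rule limit_of_inverse_square_derivative[OF f]) (assumption, rule r, assumption, simp)
  then obtain A where A: "\<And>t. 1 \<le> t \<Longrightarrow> \<bar>f t - A\<bar> \<le> K0 / t" by blast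
  have "\<exists>B. \<forall>t\<ge>1. \<bar>g t - B\<bar> \<le> K0 / t"
    by (rule limit_of_inverse_square_derivative[OF g]) (assumption, rule r, assumption, simp)
  then obtain B where B: "\<And>t. 1 \<le> t \<Longrightarrow> \<bar>g t - B\<bar> \<le> K0 / t" by blast
  have prod_le: "\<bar>a * c\<bar> \<le> b" if "\<bar>a\<bar> \<le> b" "\<bar>c\<bar> \<le> 1" for a b c :: real
    using mult_mono[OF that] that by (simp add: abs_mult)
  have far: "\<bar>bessel_u t - (A * cos t + B * sin t)\<bar> \<le> 2 * K0 * (1 / t)" if "1 \<le> t" for t
  proof -
    have "bessel_u t = bessel_u t * ((sin t)\<^sup>2 + (cos t)\<^sup>2)" by simp
    also have "\<dots> = f t * cos t + g t * sin t"
      unfolding f_def g_def by algebra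
    finally have "bessel_u t - (A * cos t + B * sin t) = (f t - A) * cos t + (g t - B) * sin t"
      by (simp add: algebra_simps)
    moreover have "\<bar>(f t - A) * cos t\<bar> \<le> K0 / t" "\<bar>(g t - B) * sin t\<bar> \<le> K0 / t"
      by (rule prod_le[OF A[OF that]], simp) (rule prod_le[OF B[OF that]], simp)
    moreover have "2 * K0 * (1 / t) = K0 / t + K0 / t" by simp
    ultimately show ?thesis by linarith
  qed
  have near: "\<bar>bessel_u t - (A * cos t + B * sin t)\<bar> \<le> K0 + \<bar>A\<bar> + \<bar>B\<bar>" if "0 < t" for t
    using K0(2)[OF that] prod_le[of A "\<bar>A\<bar>" "cos t"] prod_le[of B "\<bar>B\<bar>" "sin t"] by simp
  define K where "K = 2 * K0 + \<bar>A\<bar> + \<bar>B\<bar>"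
  have "\<bar>bessel_u t - (A * cos t + B * sin t)\<bar> \<le> K * t powr - \<theta>" if "\<theta> \<in> {0..1}" "0 < t" for \<theta> t
  proof (cases "1 \<le> t")
    case True
    have "1 / t = t powr - 1" using that by (simp add: powr_minus_divide)
    also have "\<dots> \<le> t powr - \<theta>" using True that by (intro powr_mono) auto
    finally have "2 * K0 * (1 / t) \<le> K * t powr - \<theta>"
      using K0(1) that by (intro mult_mono) (auto simp: K_def)
    with far[OF True] show ?thesis by linarith
  next
    case False
    have "1 = t powr 0" using that by simp
    also have "\<dots> \<le> t powr - \<theta>" using False that by (intro powr_mono') auto
    finally have "(K0 + \<bar>A\<bar> + \<bar>B\<bar>) * 1 \<le> K * t powr - \<theta>"
      using K0(1) by (intro mult_mono) (auto simp: K_def)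
    with near[OF that(2)] show ?thesis by simp
  qed
  moreover have "0 \<le> K" using K0(1) by (simp add: K_def)
  ultimately show ?thesis by blast
qed

section \<open>Exponential sums with nearly integer frequencies\<close>

lemma norm_cis_diff_le: "norm (cis a - cis b) \<le> \<bar>a - b\<bar>"
proof -
  have "cis a - cis b = cis b * (cis (a - b) - 1)"
    by (simp add: right_diff_distrib cis_mult)
  then have "norm (cis a - cis b) = 2 * \<bar>sin ((a - b) / 2)\<bar>"
    by (simp add: norm_mult cis_conv_exp dist_exp_i_1 del: of_real_diff)
  also have "\<dots> \<le> 2 * \<bar>(a - b) / 2\<bar>"
    by (intro mult_left_mono abs_sin_x_le_abs_x) auto
  finally show ?thesis by simp
qed

text \<open>
  The graph of a concave function lies above its chord.
\<close>
lemma sin_half_pi_ge: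
  assumes "x \<in> {0..1}"
  shows "x \<le> sin (pi / 2 * x)"
proof -
  have "concave_on {0..1} (\<lambda>x. sin (pi / 2 * x))"
  proof (rule f''_le0_imp_concave[where f' = "\<lambda>x. pi / 2 * cos (pi / 2 * x)"
        and f'' = "\<lambda>x. - (pi / 2) * (pi / 2) * sin (pi / 2 * x)"])
    show "- (pi / 2) * (pi / 2) * sin (pi / 2 * x) \<le> 0" if "x \<in> {0..1}" for x
      using that mult_left_le[of x pi] by (simp add: sin_ge_zero zero_le_mult_iff)
  qed (auto intro!: derivative_eq_intros)
  from concave_onD_Icc'[OF this assms] show ?thesis by simp
qed

text \<open>
  The norm equals $2 \sin (\pi x) = 4 \sin (\pi x / 2) \sin (\pi (1 - x) / 2)$; the two
  factors vanish at the two end points, where the exponential sums below can be large.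
\<close>
lemma norm_one_minus_cis_ge:
  assumes "x \<in> {0..1}"
  shows "4 * (x * (1 - x)) \<le> norm (1 - cis (2 * pi * x))"
proof -
  have "norm (1 - cis (2 * pi * x)) = 2 * \<bar>sin (pi * x)\<bar>"
    using dist_exp_i_1[of "2 * pi * x"] by (simp add: norm_minus_commute cis_conv_exp mult_ac)
  also have "sin (pi * x) = 2 * sin (pi / 2 * x) * cos (pi / 2 * x)"
    using sin_double[of "pi / 2 * x"] by simp
  also have "cos (pi / 2 * x) = sin (pi / 2 - pi / 2 * x)"
    by (simp add: sin_diff)
  also have "pi / 2 - pi / 2 * x = pi / 2 * (1 - x)" by (simp add: right_diff_distrib)
  finally have "norm (1 - cis (2 * pi * x)) = 4 * \<bar>sin (pi / 2 * x) * sin (pi / 2 * (1 - x))\<bar>"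
    by (simp add: abs_mult)
  moreover have "x * (1 - x) \<le> sin (pi / 2 * x) * sin (pi / 2 * (1 - x))"
    using sin_half_pi_ge[of x] sin_half_pi_ge[of "1 - x"] assms by (intro mult_mono) auto
  ultimately show ?thesis by linarith
qed

text \<open>
  Multiplication by $1 - e^{2 \pi i x}$ turns the sum into a telescoping one, up to the
  deviations of the frequency increments from $2 \pi$, whose total is finite.
\<close>
lemma exp_sum_bound:
  fixes s :: "nat \<Rightarrow> real"
  assumes summ: "summable (\<lambda>k. \<bar>s (Suc k) - s k - 2 * pi\<bar>)"
  shows "\<exists>C\<ge>0. \<forall>n. \<forall>x\<in>{0<..<1}. norm (\<Sum>k<n. cis (s k * x)) \<le> C / (x * (1 - x))"
proof -
  define D where "D = (\<Sum>k. \<bar>s (Suc k) - s k - 2 * pi\<bar>)"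
  have "norm (\<Sum>k<n. cis (s k * x)) \<le> (2 + D) / 4 / (x * (1 - x))" if x: "x \<in> {0<..<1}" for n x
  proof -
    let ?w = "cis (2 * pi * x)" and ?S = "\<Sum>k<n. cis (s k * x)"
    let ?e = "\<lambda>k. cis (s (Suc k) * x) - cis (s k * x + 2 * pi * x)"
    have "(1 - ?w) * ?S = (\<Sum>k<n. (1 - ?w) * cis (s k * x))"
      by (rule sum_distrib_left)
    also have "\<dots> = (\<Sum>k<n. (cis (s k * x) - cis (s (Suc k) * x)) + ?e k)"
      by (intro sum.cong refl) (simp add: algebra_simps cis_mult)
    also have "\<dots> = (cis (s 0 * x) - cis (s n * x)) + (\<Sum>k<n. ?e k)"
      unfolding sum.distrib by (subst sum_lessThan_telescope') rule
    finally have "norm (1 - ?w) * norm ?S = norm ((cis (s 0 * x) - cis (s n * x)) + (\<Sum>k<n. ?e k))"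
      by (metis norm_mult)
    also have "\<dots> \<le> norm (cis (s 0 * x)) + norm (cis (s n * x)) + (\<Sum>k<n. norm (?e k))"
      by (intro order_trans[OF norm_triangle_ineq] add_mono norm_triangle_ineq4 norm_sum)
    also have "(\<Sum>k<n. norm (?e k)) \<le> (\<Sum>k<n. \<bar>s (Suc k) - s k - 2 * pi\<bar>)"
    proof (rule sum_mono)
      fix k
      have "norm (?e k) \<le> \<bar>s (Suc k) * x - (s k * x + 2 * pi * x)\<bar>" by (rule norm_cis_diff_le)
      also have "s (Suc k) * x - (s k * x + 2 * pi * x) = (s (Suc k) - s k - 2 * pi) * x"
        by (simp add: algebra_simps)
      also have "\<bar>\<dots>\<bar> = \<bar>s (Suc k) - s k - 2 * pi\<bar> * x"
        using x by (simp add: abs_mult)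
      also have "\<dots> \<le> \<bar>s (Suc k) - s k - 2 * pi\<bar>"
        using x by (intro mult_left_le) auto
      finally show "norm (?e k) \<le> \<bar>s (Suc k) - s k - 2 * pi\<bar>" .
    qed
    also have "\<dots> \<le> D"
      unfolding D_def by (rule sum_le_suminf[OF summ]) auto
    finally have "norm (1 - ?w) * norm ?S \<le> 2 + D" by simp
    moreover have "4 * (x * (1 - x)) * norm ?S \<le> norm (1 - ?w) * norm ?S"
      using x by (intro mult_right_mono norm_one_minus_cis_ge) auto
    ultimately have "4 * (x * (1 - x)) * norm ?S \<le> 2 + D" by linarith
    moreover have "0 < x * (1 - x)" using x by simp
    ultimately show ?thesis by (simp add: field_simps)
  qed
  moreover have "0 \<le> D" unfolding D_def by (rule suminf_nonneg[OF summ]) auto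
  ultimately show ?thesis by (intro exI[of _ "(2 + D) / 4"]) auto
qed

lemma abel_summation:
  fixes z :: "nat \<Rightarrow> 'a::real_vector"
  shows "(\<Sum>k<n. c k *\<^sub>R z k) = c n *\<^sub>R sum z {..<n} + (\<Sum>k<n. (c k - c (Suc k)) *\<^sub>R sum z {..<Suc k})"
  by (induction n) (auto simp: algebra_simps)

lemma powr_Suc_diff_le:
  assumes "0 < p" "p < 1"
  shows "real (Suc k) powr p - real k powr p \<le> real (Suc k) powr (p - 1)"
proof (cases "k = 0")
  case True
  then show ?thesis using assms by simp
next
  case False
  have "real (Suc k) powr p = real (Suc k) * real (Suc k) powr (p - 1)"
    by (simp add: powr_diff)
  moreover have "real k powr p = real k * real k powr (p - 1)"
    using False by (simp add: powr_diff)
  moreover have "real (Suc k) powr (p - 1) \<le> real k powr (p - 1)"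
    using assms False by (intro powr_mono2') auto
  then have "real k * real (Suc k) powr (p - 1) \<le> real k * real k powr (p - 1)"
    by (intro mult_left_mono) auto
  ultimately show ?thesis by (simp add: algebra_simps)
qed

text \<open>
  Partial summation used twice: once to estimate the sum through the bounds on its partial
  sums, and then backwards, to identify the estimate with the sum of $c_k ((k+1)^p - k^p)$.
\<close>
lemma abel_bound:
  fixes z :: "nat \<Rightarrow> 'a::real_normed_vector"
  assumes c: "\<And>k. 0 \<le> c k" "\<And>k. c (Suc k) \<le> c k"
    and S: "\<And>n. norm (sum z {..<n}) \<le> W * real n powr p"
    and p: "0 < p" "p < 1"
  shows "norm (\<Sum>k<n. c k *\<^sub>R z k) \<le> W * (\<Sum>k<n. c k * real (Suc k) powr (p - 1))"
proof -
  have "0 \<le> W" using order_trans[OF norm_ge_zero S[of 1]] by simp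
  let ?y = "\<lambda>k. real (Suc k) powr p - real k powr p"
  have tele: "sum ?y {..<n} = real n powr p" for n
    using sum_lessThan_telescope[of "\<lambda>k. real k powr p" n] p by simp
  have "norm (\<Sum>k<n. c k *\<^sub>R z k) \<le>
      c n * norm (sum z {..<n}) + (\<Sum>k<n. (c k - c (Suc k)) * norm (sum z {..<Suc k}))"
    unfolding abel_summation[of c z n]
    by (intro order_trans[OF norm_triangle_ineq] add_mono order_trans[OF norm_sum] sum_mono) (auto simp: c)
  also have "\<dots> \<le> c n * (W * real n powr p) + (\<Sum>k<n. (c k - c (Suc k)) * (W * real (Suc k) powr p))"
    by (intro add_mono sum_mono mult_left_mono S) (auto simp: c)
  also have "\<dots> = W * (c n *\<^sub>R sum ?y {..<n} + (\<Sum>k<n. (c k - c (Suc k)) *\<^sub>R sum ?y {..<Suc k}))"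
    unfolding tele by (simp add: algebra_simps sum_distrib_left)
  also have "\<dots> = W * (\<Sum>k<n. c k *\<^sub>R ?y k)"
    by (simp only: abel_summation[of c ?y n])
  also have "\<dots> \<le> W * (\<Sum>k<n. c k * real (Suc k) powr (p - 1))"
    unfolding real_scaleR_def using p \<open>0 \<le> W\<close> c by (intro mult_left_mono sum_mono powr_Suc_diff_le) auto
  finally show ?thesis .
qed

lemma sum_powr_bounded:
  fixes s :: "nat \<Rightarrow> real"
  assumes "0 < d" "\<And>k. d * real (Suc k) \<le> s k" "1 < a"
  shows "\<exists>C\<ge>0. \<forall>n. (\<Sum>k<n. s k powr - a) \<le> C"
proof -
  have summ: "summable (\<lambda>k. d powr - a * real (Suc k) powr - a)"
    using assms(3) by (intro summable_mult) (subst summable_Suc_iff, simp add: summable_real_powr_iff)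
  have "(\<Sum>k<n. s k powr - a) \<le> (\<Sum>k. d powr - a * real (Suc k) powr - a)" for n
  proof -
    have "(\<Sum>k<n. s k powr - a) \<le> (\<Sum>k<n. d powr - a * real (Suc k) powr - a)"
    proof (rule sum_mono)
      fix k
      have "s k powr - a \<le> (d * real (Suc k)) powr - a"
        using assms by (intro powr_mono2') auto
      then show "s k powr - a \<le> d powr - a * real (Suc k) powr - a"
        using assms(1) by (simp add: powr_mult)
    qed
    also have "\<dots> \<le> (\<Sum>k. d powr - a * real (Suc k) powr - a)"
      by (rule sum_le_suminf[OF summ]) auto
    finally show ?thesis .
  qed
  moreover have "0 \<le> (\<Sum>k. d powr - a * real (Suc k) powr - a)"
    by (rule suminf_nonneg[OF summ]) auto
  ultimately show ?thesis by blast
qed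

text \<open>
  The partial sums are bounded by $n$ and by a multiple of $1 / (x (1 - x))$, hence by the
  geometric mean of the two with exponents $1 - \theta$ and $\theta$. Partial summation then
  costs the factor $\sum_k s_k^{-\gamma} k^{-\theta}$, which is finite because $\gamma +
  \theta > 1$. Using only the second bound would give the exponent $1$, which is not
  integrable.
\<close>
lemma weighted_exp_sum_bound:
  fixes s :: "nat \<Rightarrow> real"
  assumes summ: "summable (\<lambda>k. \<bar>s (Suc k) - s k - 2 * pi\<bar>)"
    and lower: "0 < d" "\<And>k. d * real (Suc k) \<le> s k" and mono: "\<And>k. s k \<le> s (Suc k)"
    and exponents: "0 \<le> \<gamma>" "0 < \<theta>" "\<theta> < 1" "1 < \<gamma> + \<theta>"
  shows "\<exists>C\<ge>0. \<forall>n. \<forall>x\<in>{0<..<1}.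
           norm (\<Sum>k<n. s k powr - \<gamma> *\<^sub>R cis (s k * x)) \<le> C * (x * (1 - x)) powr - \<theta>"
proof -
  obtain C0 where C0: "0 \<le> C0"
    "\<And>n x. x \<in> {0<..<1} \<Longrightarrow> norm (\<Sum>k<n. cis (s k * x)) \<le> C0 / (x * (1 - x))"
    using exp_sum_bound[OF summ] by blast
  obtain C1 where C1: "0 \<le> C1" "\<And>n. (\<Sum>k<n. (d * real (Suc k)) powr - (\<gamma> + \<theta>)) \<le> C1"
    using sum_powr_bounded[OF \<open>0 < d\<close> order_refl \<open>1 < \<gamma> + \<theta>\<close>] by blast
  have s_pos: "0 < s k" for k
    using lower(2)[of k] \<open>0 < d\<close> by (smt (verit) mult_pos_pos of_nat_0_less_iff zero_less_Suc)
  have "norm (\<Sum>k<n. s k powr - \<gamma> *\<^sub>R cis (s k * x)) \<le> C0 powr \<theta> * d powr \<theta> * C1 * (x * (1 - x)) powr - \<theta>"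
    if x: "x \<in> {0<..<1}" for n x
  proof -
    have w: "0 < x * (1 - x)" using x by simp
    let ?W = "(C0 / (x * (1 - x))) powr \<theta>"
    let ?R = "\<Sum>k<n. s k powr - \<gamma> * real (Suc k) powr ((1 - \<theta>) - 1)"
    have "norm (\<Sum>k<n. s k powr - \<gamma> *\<^sub>R cis (s k * x)) \<le> ?W * ?R"
    proof (rule abel_bound)
      show "s (Suc k) powr - \<gamma> \<le> s k powr - \<gamma>" for k
        using mono s_pos exponents by (intro powr_mono2') auto
      fix n
      let ?S = "norm (\<Sum>k<n. cis (s k * x))"
      have triv: "?S \<le> real n"
        using norm_sum[of "\<lambda>k. cis (s k * x)" "{..<n}"] by simp
      have "?S = ?S powr \<theta> * ?S powr (1 - \<theta>)"
        by (simp flip: powr_add)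
      also have "\<dots> \<le> ?W * real n powr (1 - \<theta>)"
        using C0(2)[OF x] triv exponents by (intro mult_mono powr_mono2) auto
      finally show "?S \<le> ?W * real n powr (1 - \<theta>)" .
    qed (use exponents in auto)
    moreover have "?R \<le> d powr \<theta> * C1"
    proof -
      have "?R \<le> (\<Sum>k<n. d powr \<theta> * (d * real (Suc k)) powr - (\<gamma> + \<theta>))"
    proof (rule sum_mono)
      fix k
      have "s k powr - \<gamma> * real (Suc k) powr ((1 - \<theta>) - 1) \<le> (d * real (Suc k)) powr - \<gamma> * real (Suc k) powr - \<theta>"
        using lower exponents by (intro mult_mono powr_mono2') auto
      also have "\<dots> = d powr \<theta> * (d * real (Suc k)) powr - (\<gamma> + \<theta>)"
      proof -
        have "real (Suc k) powr - \<theta> = d powr \<theta> * (d * real (Suc k)) powr - \<theta>"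
          using \<open>0 < d\<close> by (simp add: powr_mult powr_minus del: of_nat_Suc)
        moreover have "(d * real (Suc k)) powr - (\<gamma> + \<theta>) = (d * real (Suc k)) powr - \<gamma> * (d * real (Suc k)) powr - \<theta>"
          by (simp flip: powr_add)
        ultimately show ?thesis by (simp only: mult_ac)
      qed
      finally show "s k powr - \<gamma> * real (Suc k) powr ((1 - \<theta>) - 1) \<le> d powr \<theta> * (d * real (Suc k)) powr - (\<gamma> + \<theta>)" .
    qed
      also have "\<dots> \<le> d powr \<theta> * C1"
        unfolding sum_distrib_left[symmetric] by (intro mult_left_mono C1) auto
      finally show ?thesis .
    qed
    then have "?W * ?R \<le> ?W * (d powr \<theta> * C1)" by (rule mult_left_mono) simp
    moreover have "?W = C0 powr \<theta> * (x * (1 - x)) powr - \<theta>"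
      by (subst powr_divide) (use C0(1) w in \<open>simp_all add: powr_minus divide_inverse less_imp_le\<close>)
    ultimately show ?thesis by (simp add: mult_ac)
  qed
  moreover have "0 \<le> C0 powr \<theta> * d powr \<theta> * C1" using C1(1) by simp
  ultimately show ?thesis by blast
qed

section \<open>Bessel sums along arithmetic progressions of zeros\<close>

text \<open>
  Each summand is $s_k^{\alpha - 1/2} u(s_k x)$. The trigonometric part of $u$ leads to the
  weighted exponential sums, and the remainder is bounded by $\sum_k s_k^{\alpha - 1/2} (s_k
  x)^{-\theta}$, where the sum over $k$ converges.
\<close>
lemma bessel_sum_bound:
  fixes s :: "nat \<Rightarrow> real"
  assumes summ: "summable (\<lambda>k. \<bar>s (Suc k) - s k - 2 * pi\<bar>)"
    and lower: "0 < d" "\<And>k. d * real (Suc k) \<le> s k" and mono: "\<And>k. s k \<le> s (Suc k)"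
    and exponents: "\<alpha> \<le> 1 / 2" "\<alpha> + 1 / 2 < \<theta>" "0 < \<theta>" "\<theta> < 1"
  shows "\<exists>C\<ge>0. \<forall>n. \<forall>x\<in>{0<..<1}.
           \<bar>sqrt x * (\<Sum>k<n. s k powr \<alpha> * bessel_J 0 (s k * x))\<bar> \<le> C * (x * (1 - x)) powr - \<theta>"
proof -
  define \<gamma> where "\<gamma> = 1 / 2 - \<alpha>"
  have \<gamma>: "0 \<le> \<gamma>" "1 < \<gamma> + \<theta>" using exponents by (auto simp: \<gamma>_def)
  obtain A B K where K: "0 \<le> K"
    and asymp: "\<And>t. 0 < t \<Longrightarrow> \<bar>bessel_u t - (A * cos t + B * sin t)\<bar> \<le> K * t powr - \<theta>"
    using bessel_u_asymptotics exponents by (metis atLeastAtMost_iff less_imp_le)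
  define e where "e = (\<lambda>t. bessel_u t - (A * cos t + B * sin t))"
  have e: "\<bar>e t\<bar> \<le> K * t powr - \<theta>" if "0 < t" for t
    unfolding e_def by (rule asymp[OF that])
  obtain C1 where C1: "0 \<le> C1" "\<And>n x. x \<in> {0<..<1} \<Longrightarrow>
      norm (\<Sum>k<n. s k powr - \<gamma> *\<^sub>R cis (s k * x)) \<le> C1 * (x * (1 - x)) powr - \<theta>"
    using weighted_exp_sum_bound[OF summ lower mono \<gamma>(1) exponents(3,4) \<gamma>(2)] by blast
  obtain C2 where C2: "0 \<le> C2" "\<And>n. (\<Sum>k<n. s k powr - (\<gamma> + \<theta>)) \<le> C2"
    using sum_powr_bounded[OF lower \<gamma>(2)] by blast
  have s_pos: "0 < s k" for k
    using lower(2)[of k] \<open>0 < d\<close> by (smt (verit) mult_pos_pos of_nat_0_less_iff zero_less_Suc)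
  have "\<bar>sqrt x * (\<Sum>k<n. s k powr \<alpha> * bessel_J 0 (s k * x))\<bar>
      \<le> (\<bar>A\<bar> * C1 + \<bar>B\<bar> * C1 + K * C2) * (x * (1 - x)) powr - \<theta>"
    if x: "x \<in> {0<..<1}" for n x
  proof -
    let ?h = "(x * (1 - x)) powr - \<theta>"
    let ?T = "\<Sum>k<n. s k powr - \<gamma> *\<^sub>R cis (s k * x)"
    let ?R = "\<Sum>k<n. s k powr - \<gamma> * e (s k * x)"
    have "sqrt x * (\<Sum>k<n. s k powr \<alpha> * bessel_J 0 (s k * x)) = (\<Sum>k<n. s k powr - \<gamma> * bessel_u (s k * x))"
      unfolding sum_distrib_left
    proof (intro sum.cong refl)
      fix k
      have "s k powr \<alpha> = s k powr - \<gamma> * sqrt (s k)"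
        using s_pos[of k] by (simp add: \<gamma>_def powr_half_sqrt[symmetric] flip: powr_add)
      then show "sqrt x * (s k powr \<alpha> * bessel_J 0 (s k * x)) = s k powr - \<gamma> * bessel_u (s k * x)"
        by (simp add: bessel_u_def real_sqrt_mult)
    qed
    also have "\<dots> = A * Re ?T + B * Im ?T + ?R"
      by (simp add: e_def Re_sum Im_sum sum_distrib_left algebra_simps flip: sum.distrib)
    finally have eq: "sqrt x * (\<Sum>k<n. s k powr \<alpha> * bessel_J 0 (s k * x)) = A * Re ?T + B * Im ?T + ?R" .
    have "\<bar>A * Re ?T\<bar> \<le> \<bar>A\<bar> * (C1 * ?h)" "\<bar>B * Im ?T\<bar> \<le> \<bar>B\<bar> * (C1 * ?h)"
      unfolding abs_mult
      by (intro mult_left_mono order_trans[OF abs_Re_le_cmod] order_trans[OF abs_Im_le_cmod] C1 x; simp)+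
    moreover have "\<bar>?R\<bar> \<le> K * C2 * ?h"
    proof -
      have "\<bar>?R\<bar> \<le> (\<Sum>k<n. s k powr - \<gamma> * (K * (s k * x) powr - \<theta>))"
        using x s_pos by (intro order_trans[OF sum_abs] sum_mono) (auto simp: abs_mult intro!: mult_left_mono e)
      also have "\<dots> = K * x powr - \<theta> * (\<Sum>k<n. s k powr - (\<gamma> + \<theta>))"
        using x s_pos unfolding sum_distrib_left
        by (intro sum.cong refl) (simp add: powr_mult less_imp_le powr_diff powr_minus field_simps)
      also have "\<dots> \<le> K * ?h * C2"
      proof (intro mult_mono mult_left_mono C2)
        show "x powr - \<theta> \<le> ?h"
          using x exponents by (intro powr_mono2') (auto simp: mult_left_le)
      qed (use K in \<open>auto intro: sum_nonneg\<close>)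
      finally show ?thesis by (simp add: mult_ac)
    qed
    ultimately show ?thesis unfolding eq by (simp add: algebra_simps)
  qed
  moreover have "0 \<le> \<bar>A\<bar> * C1 + \<bar>B\<bar> * C1 + K * C2"
    using K C1(1) C2(1) by simp
  ultimately show ?thesis by blast
qed

definition bessel_kernel :: "real \<Rightarrow> nat set \<Rightarrow> nat \<Rightarrow> real \<Rightarrow> real" where
  "bessel_kernel \<alpha> P N x =
     (\<Sum>m\<in>{1..N} \<inter> P. bessel_J0_zero m powr \<alpha> * bessel_J 0 (bessel_J0_zero m * x))"

text \<open>
  A majorant uniform in $N$. On the closed interval it includes that the kernels vanish at
  $1$, since the right-hand side is $0$ at both end points.
\<close>
definition bessel_kernels_dominated :: "real \<Rightarrow> real \<Rightarrow> nat set \<Rightarrow> bool" where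
  "bessel_kernels_dominated \<alpha> \<theta> P \<longleftrightarrow>
     (\<exists>C\<ge>0. \<forall>N. \<forall>x\<in>{0..1}. \<bar>sqrt x * bessel_kernel \<alpha> P N x\<bar> \<le> C * (x * (1 - x)) powr - \<theta>)"

lemma bessel_kernel_at_1 [simp]: "bessel_kernel \<alpha> P N 1 = 0"
  by (simp add: bessel_kernel_def)

lemma bessel_kernels_dominatedI:
  assumes "0 \<le> C"
    "\<And>N x. x \<in> {0<..<1} \<Longrightarrow> \<bar>sqrt x * bessel_kernel \<alpha> P N x\<bar> \<le> C * (x * (1 - x)) powr - \<theta>"
  shows "bessel_kernels_dominated \<alpha> \<theta> P"
  unfolding bessel_kernels_dominated_def
proof (intro exI[of _ C] conjI allI ballI)
  fix N and x :: real assume "x \<in> {0..1}"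
  then consider "x = 0" | "x = 1" | "x \<in> {0<..<1}" by fastforce
  then show "\<bar>sqrt x * bessel_kernel \<alpha> P N x\<bar> \<le> C * (x * (1 - x)) powr - \<theta>"
    by cases (use assms in auto)
qed (rule assms)

text \<open>
  Along a progression of step two, two consecutive gaps between zeros add up to $2 \pi$ with
  an error of order $k^{-2}$.
\<close>
lemma bessel_kernels_dominated_progression:
  assumes "\<alpha> \<le> 1 / 2" "\<alpha> + 1 / 2 < \<theta>" "0 < \<theta>" "\<theta> < 1" and "1 \<le> r"
    and progression: "\<And>N. \<exists>n. {1..N} \<inter> P = (\<lambda>k. 2 * k + r) ` {..<n}"
  shows "bessel_kernels_dominated \<alpha> \<theta> P"
proof -
  define s where "s = (\<lambda>k. bessel_J0_zero (2 * k + r))"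
  obtain d where d: "0 < d" "\<And>m. 1 \<le> m \<Longrightarrow> d * real m \<le> bessel_J0_zero m"
    using bessel_J0_zero_linear_lower_bound by blast
  have lower: "d * real (Suc k) \<le> bessel_J0_zero m" if "Suc k \<le> m" for k m
  proof -
    have "d * real (Suc k) \<le> d * real m" using d(1) that by (intro mult_left_mono) auto
    also have "\<dots> \<le> bessel_J0_zero m" using that by (intro d(2)) auto
    finally show ?thesis .
  qed
  have inv: "1 / (bessel_J0_zero m)\<^sup>2 \<le> 1 / d\<^sup>2 * (1 / real (Suc k) ^ 2)" if "Suc k \<le> m" for k m
  proof -
    have "1 / (bessel_J0_zero m)\<^sup>2 \<le> 1 / (d * real (Suc k))\<^sup>2"
      using d(1) lower[OF that] that by (intro divide_left_mono power_mono mult_pos_pos zero_less_power bessel_J0_zero_pos) auto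
    then show ?thesis by (simp add: power_mult_distrib)
  qed
  have gap: "\<bar>s (Suc k) - s k - 2 * pi\<bar> \<le> 2 / d\<^sup>2 * (1 / real (Suc k) ^ 2)" for k
  proof -
    let ?m = "2 * k + r"
    have "s (Suc k) - s k - 2 * pi = (bessel_J0_zero (Suc (Suc ?m)) - bessel_J0_zero (Suc ?m) - pi)
        + (bessel_J0_zero (Suc ?m) - bessel_J0_zero ?m - pi)"
      by (simp add: s_def)
    moreover have "\<bar>bessel_J0_zero (Suc (Suc ?m)) - bessel_J0_zero (Suc ?m) - pi\<bar> \<le> 1 / d\<^sup>2 * (1 / real (Suc k) ^ 2)"
      using \<open>1 \<le> r\<close> by (intro order_trans[OF bessel_J0_zero_gap inv]) auto
    moreover have "\<bar>bessel_J0_zero (Suc ?m) - bessel_J0_zero ?m - pi\<bar> \<le> 1 / d\<^sup>2 * (1 / real (Suc k) ^ 2)"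
      using \<open>1 \<le> r\<close> by (intro order_trans[OF bessel_J0_zero_gap inv]) auto
    ultimately show ?thesis by (simp add: abs_le_iff)
  qed
  have "summable (\<lambda>k. \<bar>s (Suc k) - s k - 2 * pi\<bar>)"
  proof (rule summable_comparison_test)
    show "\<exists>N. \<forall>k\<ge>N. norm \<bar>s (Suc k) - s k - 2 * pi\<bar> \<le> 2 / d\<^sup>2 * (1 / real (Suc k) ^ 2)"
      using gap by simp
    show "summable (\<lambda>k. 2 / d\<^sup>2 * (1 / real (Suc k) ^ 2))"
      using inverse_power_summable[of 2, where ?'a = real]
      by (intro summable_mult) (subst summable_Suc_iff, simp add: divide_inverse)
  qed
  moreover have "d * real (Suc k) \<le> s k" "s k \<le> s (Suc k)" for k
    using lower[of k] \<open>1 \<le> r\<close> bessel_J0_zero_strict_mono[of "2 * k + r" "2 * Suc k + r"] by (auto simp: s_def)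
  ultimately obtain C where C: "0 \<le> C" "\<And>n x. x \<in> {0<..<1} \<Longrightarrow>
      \<bar>sqrt x * (\<Sum>k<n. s k powr \<alpha> * bessel_J 0 (s k * x))\<bar> \<le> C * (x * (1 - x)) powr - \<theta>"
    using bessel_sum_bound[of s d \<alpha> \<theta>] d(1) assms(1-4) by blast
  show ?thesis
  proof (rule bessel_kernels_dominatedI[OF C(1)])
    fix N and x :: real assume x: "x \<in> {0<..<1}"
    obtain n where n: "{1..N} \<inter> P = (\<lambda>k. 2 * k + r) ` {..<n}" using progression by blast
    have "bessel_kernel \<alpha> P N x = (\<Sum>k<n. s k powr \<alpha> * bessel_J 0 (s k * x))"
      unfolding bessel_kernel_def n s_def by (subst sum.reindex) (auto simp: inj_on_def)
    then show "\<bar>sqrt x * bessel_kernel \<alpha> P N x\<bar> \<le> C * (x * (1 - x)) powr - \<theta>"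
      using C(2)[OF x] by simp
  qed
qed

lemma bessel_kernels_dominated_odd:
  assumes "\<alpha> \<le> 1 / 2" "\<alpha> + 1 / 2 < \<theta>" "0 < \<theta>" "\<theta> < 1"
  shows "bessel_kernels_dominated \<alpha> \<theta> {m. odd m}"
proof (rule bessel_kernels_dominated_progression[OF assms, of 1])
  fix N :: nat
  have "{1..N} \<inter> {m. odd m} = (\<lambda>k. 2 * k + 1) ` {..<(N + 1) div 2}"
    by (auto elim!: oddE)
  then show "\<exists>n. {1..N} \<inter> {m. odd m} = (\<lambda>k. 2 * k + 1) ` {..<n}" by blast
qed simp

lemma bessel_kernels_dominated_even:
  assumes "\<alpha> \<le> 1 / 2" "\<alpha> + 1 / 2 < \<theta>" "0 < \<theta>" "\<theta> < 1"
  shows "bessel_kernels_dominated \<alpha> \<theta> {m. even m}"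
proof (rule bessel_kernels_dominated_progression[OF assms, of 2])
  fix N :: nat
  have "{1..N} \<inter> {m. even m} = (\<lambda>k. 2 * k + 2) ` {..<N div 2}"
  proof (intro equalityI subsetI)
    fix m assume m: "m \<in> {1..N} \<inter> {m. even m}"
    then obtain b where "m = 2 * b" by auto
    with m have "m = 2 * (b - 1) + 2" "b - 1 < N div 2" by auto
    then show "m \<in> (\<lambda>k. 2 * k + 2) ` {..<N div 2}" by blast
  qed auto
  then show "\<exists>n. {1..N} \<inter> {m. even m} = (\<lambda>k. 2 * k + 2) ` {..<n}" by blast
qed simp

lemma bessel_kernels_dominated_Un:
  assumes "bessel_kernels_dominated \<alpha> \<theta> P" "bessel_kernels_dominated \<alpha> \<theta> Q" "P \<inter> Q = {}"
  shows "bessel_kernels_dominated \<alpha> \<theta> (P \<union> Q)"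
proof -
  obtain C where C: "0 \<le> C" "\<And>N x. x \<in> {0..1} \<Longrightarrow> \<bar>sqrt x * bessel_kernel \<alpha> P N x\<bar> \<le> C * (x * (1 - x)) powr - \<theta>"
    using assms(1) unfolding bessel_kernels_dominated_def by blast
  obtain D where D: "0 \<le> D" "\<And>N x. x \<in> {0..1} \<Longrightarrow> \<bar>sqrt x * bessel_kernel \<alpha> Q N x\<bar> \<le> D * (x * (1 - x)) powr - \<theta>"
    using assms(2) unfolding bessel_kernels_dominated_def by blast
  have split: "bessel_kernel \<alpha> (P \<union> Q) N x = bessel_kernel \<alpha> P N x + bessel_kernel \<alpha> Q N x" for N x
    unfolding bessel_kernel_def Int_Un_distrib using assms(3) by (intro sum.union_disjoint) auto
  show ?thesis
  proof (rule bessel_kernels_dominatedI[of "C + D"])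
    fix N and x :: real assume "x \<in> {0<..<1}"
    then have "x \<in> {0..1}" by simp
    from C(2)[OF this, of N] D(2)[OF this, of N]
    show "\<bar>sqrt x * bessel_kernel \<alpha> (P \<union> Q) N x\<bar> \<le> (C + D) * (x * (1 - x)) powr - \<theta>"
      unfolding split distrib_left distrib_right by linarith
  qed (use C D in simp)
qed

lemma bessel_J0_bounded_on_unit_interval: "\<exists>M\<ge>0. \<forall>x\<in>{0..1}. \<bar>bessel_J 0 (c * x)\<bar> \<le> M"
proof -
  have "bounded ((\<lambda>x. bessel_J 0 (c * x)) ` {0..1})"
    by (intro compact_imp_bounded compact_continuous_image continuous_intros) auto
  then obtain M where M: "\<And>x. x \<in> {0..1} \<Longrightarrow> \<bar>bessel_J 0 (c * x)\<bar> \<le> M"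
    by (force simp: bounded_iff)
  moreover have "0 \<le> M" using M[of 0] by simp
  ultimately show ?thesis by blast
qed

lemma bessel_kernels_dominated_singleton:
  assumes "1 \<le> p" "0 < \<theta>"
  shows "bessel_kernels_dominated \<alpha> \<theta> {p}"
proof -
  let ?j = "bessel_J0_zero p"
  obtain M where M: "0 \<le> M" "\<And>x. x \<in> {0..1} \<Longrightarrow> \<bar>bessel_J 0 (?j * x)\<bar> \<le> M"
    using bessel_J0_bounded_on_unit_interval by blast
  show ?thesis
  proof (rule bessel_kernels_dominatedI[of "?j powr \<alpha> * M"])
    fix N and x :: real assume x: "x \<in> {0<..<1}"
    have "\<bar>bessel_kernel \<alpha> {p} N x\<bar> \<le> ?j powr \<alpha> * M"
      using M x \<open>1 \<le> p\<close> by (cases "p \<le> N") (auto simp: bessel_kernel_def abs_mult intro!: mult_left_mono)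
    then have "\<bar>sqrt x * bessel_kernel \<alpha> {p} N x\<bar> \<le> 1 * (?j powr \<alpha> * M)"
      unfolding abs_mult using x M(1) by (intro mult_mono) auto
    also have "1 * (?j powr \<alpha> * M) = (?j powr \<alpha> * M) * 1" by (rule mult.commute)
    also have "\<dots> \<le> (?j powr \<alpha> * M) * (x * (1 - x)) powr - \<theta>"
    proof (rule mult_left_mono)
      have "1 powr - \<theta> \<le> (x * (1 - x)) powr - \<theta>"
        using x assms by (intro powr_mono2') (auto simp: mult_le_one)
      then show "1 \<le> (x * (1 - x)) powr - \<theta>" by simp
    qed (use M in simp)
    finally show "\<bar>sqrt x * bessel_kernel \<alpha> {p} N x\<bar> \<le> (?j powr \<alpha> * M) * (x * (1 - x)) powr - \<theta>" by simp
  qed (use M in simp)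
qed

section \<open>Superposition of kernels\<close>

lemma set_integral_sums_dominated:
  fixes F :: "nat \<Rightarrow> 'a \<Rightarrow> real"
  assumes F: "\<And>k. set_integrable M A (F k)" and h: "set_integrable M A h"
    and bound: "\<And>k x. x \<in> A \<Longrightarrow> \<bar>F k x\<bar> \<le> w k * h x" and w: "summable w"
  shows "set_integrable M A (\<lambda>x. \<Sum>k. F k x)"
    and "(\<lambda>k. LINT x:A|M. F k x) sums (LINT x:A|M. (\<Sum>k. F k x))"
proof -
  let ?f = "\<lambda>k x. indicator A x *\<^sub>R F k x"
  have pull: "(\<Sum>k. ?f k x) = indicator A x *\<^sub>R (\<Sum>k. F k x)" for x
    by (cases "x \<in> A") auto
  have le: "norm (?f k x) \<le> w k * (indicator A x *\<^sub>R h x)" for k x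
    using bound[of x k] by (cases "x \<in> A") auto
  have int: "integrable M (?f k)" for k
    using F unfolding set_integrable_def .
  have inth: "integrable M (\<lambda>x. indicator A x *\<^sub>R h x)"
    using h unfolding set_integrable_def .
  have AE: "AE x in M. summable (\<lambda>k. norm (?f k x))"
  proof (intro AE_I2)
    fix x
    show "summable (\<lambda>k. norm (?f k x))"
      by (rule summable_comparison_test[OF _ summable_mult2[OF w, of "indicator A x *\<^sub>R h x"]])
         (use le in auto)
  qed
  have summ: "summable (\<lambda>k. LINT x|M. norm (?f k x))"
  proof (rule summable_comparison_test[OF _ summable_mult2[OF w, of "LINT x|M. indicator A x *\<^sub>R h x"]])
    have "(LINT x|M. norm (?f k x)) \<le> w k * (LINT x|M. indicator A x *\<^sub>R h x)" for k
    proof -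
      have "(LINT x|M. norm (?f k x)) \<le> (LINT x|M. w k * (indicator A x *\<^sub>R h x))"
        by (intro integral_mono integrable_norm integrable_mult_right int inth le)
      then show ?thesis by simp
    qed
    then show "\<exists>N. \<forall>k\<ge>N. norm (LINT x|M. norm (?f k x)) \<le> w k * (LINT x|M. indicator A x *\<^sub>R h x)"
      by simp
  qed
  show "set_integrable M A (\<lambda>x. \<Sum>k. F k x)"
    unfolding set_integrable_def using integrable_suminf[OF int AE summ] by (simp only: pull)
  show "(\<lambda>k. LINT x:A|M. F k x) sums (LINT x:A|M. (\<Sum>k. F k x))"
    unfolding set_lebesgue_integral_def using sums_integral[OF int AE summ] by (simp only: pull)
qed

text \<open>
  Take $w_k = B\, 2^{-k}$ with $B$ a bound for $|a|$, and let $N_k$ be such that $|a_m| \le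
  w_{k+1}$ beyond $N_k$. If $K$ is the first index with $m \le N_K$, the single term $w_K$
  already dominates $a_m$.
\<close>
lemma null_sequence_step_majorant:
  fixes a :: "nat \<Rightarrow> real"
  assumes "a \<longlonglongrightarrow> 0"
  shows "\<exists>w N. (\<forall>k. 0 \<le> w k) \<and> summable w \<and> (\<forall>m. a m \<le> (\<Sum>k. if m \<le> N k then w k else 0))"
proof -
  have "Bseq a" using assms convergentI convergent_imp_Bseq by blast
  then obtain B where B: "0 < B" "\<And>m. \<bar>a m\<bar> \<le> B" by (auto simp: Bseq_def)
  define w where "w = (\<lambda>k::nat. B * (1 / 2) ^ k)"
  have w: "0 < w k" for k using B(1) by (simp add: w_def)
  have summ: "summable w" unfolding w_def by (intro summable_mult summable_geometric) simp
  have "\<exists>n. \<forall>m>n. \<bar>a m\<bar> \<le> w (Suc k)" for k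
    using LIMSEQ_D[OF assms w[of "Suc k"]] by (metis diff_zero less_imp_le real_norm_def)
  then obtain N where N: "\<And>k m. N k < m \<Longrightarrow> \<bar>a m\<bar> \<le> w (Suc k)" by metis
  have "a m \<le> (\<Sum>k. if m \<le> N k then w k else 0)" for m
  proof -
    let ?t = "\<lambda>k. if m \<le> N k then w k else 0"
    have summ': "summable ?t"
      by (rule summable_comparison_test[OF _ summ]) (use w in \<open>auto simp: less_imp_le\<close>)
    have nonneg: "0 \<le> ?t k" for k using w[of k] by simp
    show ?thesis
    proof (cases "\<exists>k. m \<le> N k")
      case True
      define K where "K = (LEAST k. m \<le> N k)"
      have K: "m \<le> N K" using True unfolding K_def by (rule LeastI_ex)
      have "a m \<le> w K"
      proof (cases K)
        case 0
        then show ?thesis using B(2)[of m] by (simp add: w_def)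
      next
        case (Suc i)
        then have "\<not> m \<le> N i" unfolding K_def by (metis lessI not_less_Least)
        then show ?thesis using N[of i m] Suc by simp
      qed
      also have "\<dots> = sum ?t {K}" using K by simp
      also have "\<dots> \<le> suminf ?t" by (rule sum_le_suminf[OF summ']) (use nonneg in auto)
      finally show ?thesis .
    next
      case False
      then have "\<forall>k. \<bar>a m\<bar> \<le> w (Suc k)" using N by (simp add: not_le)
      moreover have "(\<lambda>k. w (Suc k)) \<longlonglongrightarrow> 0" using summable_LIMSEQ_zero[OF summ] by (rule LIMSEQ_Suc)
      ultimately have "\<bar>a m\<bar> \<le> 0" by (intro LIMSEQ_le_const) auto
      moreover have "0 \<le> suminf ?t" by (rule suminf_nonneg[OF summ' nonneg])
      ultimately show ?thesis by linarith
    qed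
  qed
  then show ?thesis using w summ less_imp_le by blast
qed

lemma suminf_cutoff_tendsto_0:
  fixes w :: "nat \<Rightarrow> real" and N :: "nat \<Rightarrow> nat"
  assumes "\<And>k. 0 \<le> w k" "summable w"
  shows "(\<lambda>m. \<Sum>k. if m \<le> N k then w k else 0) \<longlonglongrightarrow> 0"
proof -
  have "(\<lambda>m. \<Sum>k. if m \<le> N k then w k else 0) \<longlonglongrightarrow> (\<Sum>k. 0)"
  proof (rule tannerys_theorem[THEN conjunct2, THEN conjunct2])
    fix k
    show "(\<lambda>m. if m \<le> N k then w k else 0) \<longlonglongrightarrow> 0"
      by (rule tendsto_eventually, rule eventually_sequentiallyI[of "Suc (N k)"]) auto
    show "\<forall>\<^sub>F (k, m) in sequentially \<times>\<^sub>F sequentially. norm (if m \<le> N k then w k else 0) \<le> w k"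
      by (rule always_eventually) (use assms in auto)
  qed (use assms in auto)
  then show ?thesis by simp
qed

text \<open>
  This is a Beta integral.
\<close>
lemma set_integrable_beta_weight:
  assumes "\<theta> < 1"
  shows "set_integrable lebesgue {0..1} (\<lambda>x::real. (x * (1 - x)) powr - \<theta>)"
proof (rule nonnegative_absolutely_integrable_1)
  have "((\<lambda>x. x powr ((1 - \<theta>) - 1) * (1 - x) powr ((1 - \<theta>) - 1)) has_integral Beta (1 - \<theta>) (1 - \<theta>)) {0..1}"
    using assms by (intro has_integral_Beta_real) auto
  then have "((\<lambda>x. (x * (1 - x)) powr - \<theta>) has_integral Beta (1 - \<theta>) (1 - \<theta>)) {0..1}"
    by (rule has_integral_eq[rotated]) (simp add: powr_mult)
  then show "(\<lambda>x. (x * (1 - x)) powr - \<theta>) integrable_on {0..1}" by blast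
qed simp

lemma bessel_kernel_coeff:
  assumes "1 \<le> m"
  shows "(LINT x:{0..1}|lebesgue. bessel_kernel \<alpha> P N x * bessel_J 0 (bessel_J0_zero m * x) * x) =
    (if m \<in> P \<and> m \<le> N then bessel_J0_zero m powr \<alpha> * ((bessel_J 1 (bessel_J0_zero m))\<^sup>2 / 2) else 0)"
proof -
  let ?c = "(bessel_J 1 (bessel_J0_zero m))\<^sup>2 / 2"
  let ?g = "\<lambda>i x. bessel_J 0 (bessel_J0_zero i * x) * bessel_J 0 (bessel_J0_zero m * x) * x"
  have "((\<lambda>x. \<Sum>i\<in>{1..N} \<inter> P. bessel_J0_zero i powr \<alpha> * ?g i x) has_integral
      (\<Sum>i\<in>{1..N} \<inter> P. bessel_J0_zero i powr \<alpha> * (if i = m then ?c else 0))) {0..1}"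
    using assms by (intro has_integral_sum has_integral_mult_right bessel_J0_orthogonality) auto
  also have "(\<lambda>x. \<Sum>i\<in>{1..N} \<inter> P. bessel_J0_zero i powr \<alpha> * ?g i x) =
      (\<lambda>x. bessel_kernel \<alpha> P N x * bessel_J 0 (bessel_J0_zero m * x) * x)"
    unfolding bessel_kernel_def sum_distrib_right by (simp only: mult_ac)
  also have "(\<Sum>i\<in>{1..N} \<inter> P. bessel_J0_zero i powr \<alpha> * (if i = m then ?c else 0)) =
      (if m \<in> P \<and> m \<le> N then bessel_J0_zero m powr \<alpha> * ?c else 0)"
    using assms by (subst if_distrib) (simp add: sum.delta cong: if_cong)
  finally have I: "((\<lambda>x. bessel_kernel \<alpha> P N x * bessel_J 0 (bessel_J0_zero m * x) * x) has_integral
      (if m \<in> P \<and> m \<le> N then bessel_J0_zero m powr \<alpha> * ?c else 0)) {0..1}" .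
  have "continuous_on {0..1} (\<lambda>x. bessel_kernel \<alpha> P N x * bessel_J 0 (bessel_J0_zero m * x) * x)"
    unfolding bessel_kernel_def by (intro continuous_intros)
  then have "set_integrable lebesgue {0..1} (\<lambda>x. bessel_kernel \<alpha> P N x * bessel_J 0 (bessel_J0_zero m * x) * x)"
    by (rule absolutely_integrable_continuous_real)
  from set_lebesgue_integral_eq_integral(2)[OF this] I show ?thesis
    by (simp add: integral_unique)
qed

text \<open>
  The superposition of kernels described at the beginning, for a general index set $P$.
\<close>
lemma bessel_fourier_majorant:
  fixes a :: "nat \<Rightarrow> real" and P :: "nat set"
  assumes a: "a \<longlonglongrightarrow> 0" and dom: "bessel_kernels_dominated \<alpha> \<theta> P" and "\<theta> < 1"
  shows "\<exists>f :: real \<Rightarrow> real.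
    set_integrable lebesgue {0..1} (\<lambda>x. sqrt x * f x) \<and>
    (\<forall>m\<ge>1. m \<in> P \<longrightarrow> a m \<le> bessel_fourier_coeff f m / bessel_J0_zero m powr \<alpha>) \<and>
    (\<lambda>m. bessel_fourier_coeff f m / bessel_J0_zero m powr \<alpha>) \<longlonglongrightarrow> 0 \<and>
    (\<forall>m\<ge>1. m \<notin> P \<longrightarrow> bessel_fourier_coeff f m = 0)"
proof -
  obtain w N where w: "\<And>k. 0 \<le> w k" "summable w"
    and maj: "\<And>m. a m \<le> (\<Sum>k. if m \<le> N k then w k else 0)"
    using null_sequence_step_majorant[OF a] by blast
  obtain C where C: "0 \<le> C" "\<And>N x. x \<in> {0..1} \<Longrightarrow>
      \<bar>sqrt x * bessel_kernel \<alpha> P N x\<bar> \<le> C * (x * (1 - x)) powr - \<theta>"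
    using dom unfolding bessel_kernels_dominated_def by blast
  let ?h = "\<lambda>x. (x * (1 - x)) powr - \<theta>"
  define F where "F = (\<lambda>k x. sqrt x * (w k * bessel_kernel \<alpha> P (N k) x))"
  have F_cont: "continuous_on {0..1} (F k)" for k
    unfolding F_def bessel_kernel_def by (intro continuous_intros)
  have F_le: "\<bar>F k x\<bar> \<le> w k * (C * ?h x)" if "x \<in> {0..1}" for k x
  proof -
    have "\<bar>F k x\<bar> = w k * \<bar>sqrt x * bessel_kernel \<alpha> P (N k) x\<bar>"
      using w(1)[of k] by (simp add: F_def abs_mult)
    then show ?thesis using mult_left_mono[OF C(2)[OF that, of "N k"] w(1)[of k]] by simp
  qed
  \<comment> \<open>The weight is divided out after summation, so that the product with it is the sum also at
    the origin, where all terms vanish.\<close>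
  define f where "f = (\<lambda>x. (\<Sum>k. F k x) / sqrt x)"
  have F0: "F k 0 = 0" for k by (simp add: F_def)
  have f: "sqrt x * f x = (\<Sum>k. F k x)" for x
    by (cases "x = 0") (auto simp: f_def F0)
  have h: "set_integrable lebesgue {0..1} (\<lambda>x. c * ?h x)" for c
    using set_integrable_beta_weight[OF \<open>\<theta> < 1\<close>] by (rule set_integrable_mult_right)
  have integrable: "set_integrable lebesgue {0..1} (\<lambda>x. sqrt x * f x)"
    unfolding f
    by (rule set_integral_sums_dominated(1)[OF _ h F_le w(2)])
       (auto intro!: absolutely_integrable_continuous_real F_cont)
  define b where "b = (\<lambda>m. \<Sum>k. if m \<le> N k then w k else 0)"
  have coeff: "bessel_fourier_coeff f m = (if m \<in> P then bessel_J0_zero m powr \<alpha> * b m else 0)"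
    if m: "1 \<le> m" for m
  proof -
    let ?j = "bessel_J0_zero m"
    let ?g = "\<lambda>x. bessel_J 0 (?j * x) * sqrt x"
    define c where "c = (bessel_J 1 ?j)\<^sup>2 / 2"
    have c: "c \<noteq> 0"
      using bessel_J1_nonzero_at_zero[OF bessel_J0_zero_pos[OF m] bessel_J_0_bessel_J0_zero[OF m]]
      by (simp add: c_def)
    obtain M where M: "0 \<le> M" "\<And>x. x \<in> {0..1} \<Longrightarrow> \<bar>bessel_J 0 (?j * x)\<bar> \<le> M"
      using bessel_J0_bounded_on_unit_interval by blast
    have g_le: "\<bar>?g x\<bar> \<le> M" if "x \<in> {0..1}" for x
      using mult_mono[OF M(2)[OF that], of "sqrt x" 1] that M(1) by (simp add: abs_mult)
    have Fg_le: "\<bar>F k x * ?g x\<bar> \<le> w k * ((C * M) * ?h x)" if "x \<in> {0..1}" for k x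
    proof -
      have "\<bar>F k x * ?g x\<bar> \<le> (w k * (C * ?h x)) * M"
        unfolding abs_mult[of "F k x"] using F_le[OF that] g_le[OF that] w(1) C(1)
        by (intro mult_mono) auto
      then show ?thesis by (simp add: mult_ac)
    qed
    have "(\<lambda>k. LINT x:{0..1}|lebesgue. F k x * ?g x) sums
        (LINT x:{0..1}|lebesgue. (\<Sum>k. F k x * ?g x))"
      by (rule set_integral_sums_dominated(2)[OF _ h Fg_le w(2)])
         (auto intro!: absolutely_integrable_continuous_real continuous_intros F_cont)
    moreover have "(LINT x:{0..1}|lebesgue. (\<Sum>k. F k x * ?g x)) =
        (LINT x:{0..1}|lebesgue. f x * bessel_J 0 (?j * x) * x)"
    proof (rule set_lebesgue_integral_cong)
      show "\<forall>x. x \<in> {0..1} \<longrightarrow> (\<Sum>k. F k x * ?g x) = f x * bessel_J 0 (?j * x) * x"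
      proof (intro allI impI)
        fix x :: real assume x: "x \<in> {0..1}"
        have "summable (\<lambda>k. F k x)"
          by (rule summable_comparison_test[OF _ summable_mult2[OF w(2), of "C * ?h x"]])
             (use F_le[OF x] in simp)
        then have "(\<Sum>k. F k x * ?g x) = (\<Sum>k. F k x) * ?g x"
          by (rule suminf_mult2[symmetric])
        also have "\<dots> = f x * bessel_J 0 (?j * x) * (sqrt x * sqrt x)"
          by (simp only: f[symmetric] mult_ac)
        also have "sqrt x * sqrt x = x" using x by simp
        finally show "(\<Sum>k. F k x * ?g x) = f x * bessel_J 0 (?j * x) * x" .
      qed
    qed simp
    moreover have "(LINT x:{0..1}|lebesgue. F k x * ?g x) =
        (if m \<in> P then ?j powr \<alpha> * c else 0) * (if m \<le> N k then w k else 0)" for k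
    proof -
      have "(LINT x:{0..1}|lebesgue. F k x * ?g x) =
          (LINT x:{0..1}|lebesgue. w k * (bessel_kernel \<alpha> P (N k) x * bessel_J 0 (?j * x) * x))"
      proof (rule set_lebesgue_integral_cong)
        show "\<forall>x. x \<in> {0..1} \<longrightarrow> F k x * ?g x = w k * (bessel_kernel \<alpha> P (N k) x * bessel_J 0 (?j * x) * x)"
        proof (intro allI impI)
          fix x :: real assume "x \<in> {0..1}"
          have "F k x * ?g x = w k * (bessel_kernel \<alpha> P (N k) x * bessel_J 0 (?j * x) * (sqrt x * sqrt x))"
            by (simp only: F_def mult_ac)
          also have "sqrt x * sqrt x = x" using \<open>x \<in> {0..1}\<close> by simp
          finally show "F k x * ?g x = w k * (bessel_kernel \<alpha> P (N k) x * bessel_J 0 (?j * x) * x)" .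
        qed
      qed simp
      also have "\<dots> = w k * (if m \<in> P \<and> m \<le> N k then ?j powr \<alpha> * c else 0)"
        by (simp add: bessel_kernel_coeff[OF m] c_def)
      finally show ?thesis by simp
    qed
    ultimately have "(\<lambda>k. (if m \<in> P then ?j powr \<alpha> * c else 0) * (if m \<le> N k then w k else 0)) sums
        (LINT x:{0..1}|lebesgue. f x * bessel_J 0 (?j * x) * x)"
      by simp
    moreover have "summable (\<lambda>k. if m \<le> N k then w k else 0)"
      by (rule summable_comparison_test[OF _ w(2)]) (use w(1) in auto)
    ultimately have "(LINT x:{0..1}|lebesgue. f x * bessel_J 0 (?j * x) * x) =
        (if m \<in> P then ?j powr \<alpha> * c else 0) * b m"
      unfolding b_def by (simp only: suminf_mult sums_iff)
    then have "bessel_fourier_coeff f m = 1 / c * ((if m \<in> P then ?j powr \<alpha> * c else 0) * b m)"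
      by (simp add: bessel_fourier_coeff_def c_def)
    then show ?thesis using c by simp
  qed
  have quot: "bessel_fourier_coeff f m / bessel_J0_zero m powr \<alpha> = (if m \<in> P then b m else 0)"
    if "1 \<le> m" for m
    using coeff[OF that] bessel_J0_zero_pos[OF that] by simp
  have b0: "0 \<le> b m" for m
    unfolding b_def
    by (rule suminf_nonneg, rule summable_comparison_test[OF _ w(2)]) (use w(1) in auto)
  have "(\<lambda>m. bessel_fourier_coeff f m / bessel_J0_zero m powr \<alpha>) \<longlonglongrightarrow> 0"
  proof (rule tendsto_sandwich[where f = "\<lambda>_. 0" and h = b])
    show "b \<longlonglongrightarrow> 0" unfolding b_def by (rule suminf_cutoff_tendsto_0[OF w])
    show "\<forall>\<^sub>F m in sequentially. 0 \<le> bessel_fourier_coeff f m / bessel_J0_zero m powr \<alpha>"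
      "\<forall>\<^sub>F m in sequentially. bessel_fourier_coeff f m / bessel_J0_zero m powr \<alpha> \<le> b m"
      by (intro eventually_sequentiallyI[of 1]; simp add: quot b0)+
  qed simp
  moreover have "\<forall>m\<ge>1. m \<in> P \<longrightarrow> a m \<le> bessel_fourier_coeff f m / bessel_J0_zero m powr \<alpha>"
    using maj by (auto simp: quot b_def)
  moreover have "\<forall>m\<ge>1. m \<notin> P \<longrightarrow> bessel_fourier_coeff f m = 0"
    by (simp add: coeff)
  ultimately show ?thesis using integrable by blast
qed

theorem theorem4p1:
  fixes a :: "nat \<Rightarrow> real" and \<alpha> :: real
  assumes fejer_conjecture:
      "\<forall>\<beta>\<in>{0..1/2}. \<forall>M\<ge>1. \<forall>x\<in>{0..1}. modified_fejer_kernel \<beta> M x \<ge> 0"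
    and a_nonneg: "\<forall>m\<ge>1. a m \<ge> 0"
    and a_lim: "a \<longlonglongrightarrow> 0"
    and alpha: "0 \<le> \<alpha>" "\<alpha> < 1/2"
  shows
    "(\<exists>f :: real \<Rightarrow> real.
        set_integrable lebesgue {0..1} (\<lambda>x. sqrt x * f x) \<and>
        (\<forall>m\<ge>1. 0 \<le> a m \<and> a m \<le> bessel_fourier_coeff f m / bessel_J0_zero m powr \<alpha>) \<and>
        (\<lambda>m. bessel_fourier_coeff f m / bessel_J0_zero m powr \<alpha>) \<longlonglongrightarrow> 0) \<and>
     (\<exists>f :: real \<Rightarrow> real.
        set_integrable lebesgue {0..1} (\<lambda>x. sqrt x * f x) \<and>
        (\<forall>m\<ge>1. (\<nexists>k. k \<ge> 1 \<and> m = 2 * k) \<longrightarrow>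
           0 \<le> a m \<and> a m \<le> bessel_fourier_coeff f m / bessel_J0_zero m powr \<alpha>) \<and>
        (\<lambda>m. bessel_fourier_coeff f m / bessel_J0_zero m powr \<alpha>) \<longlonglongrightarrow> 0 \<and>
        (\<forall>m\<ge>1. bessel_fourier_coeff f (2 * m) = 0)) \<and>
     (\<exists>f :: real \<Rightarrow> real.
        set_integrable lebesgue {0..1} (\<lambda>x. sqrt x * f x) \<and>
        (\<forall>m\<ge>1. (\<nexists>k. k \<ge> 1 \<and> m = 2 * k + 1) \<longrightarrow>
           0 \<le> a m \<and> a m \<le> bessel_fourier_coeff f m / bessel_J0_zero m powr \<alpha>) \<and>
        (\<lambda>m. bessel_fourier_coeff f m / bessel_J0_zero m powr \<alpha>) \<longlonglongrightarrow> 0 \<and>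
        (\<forall>m\<ge>1. bessel_fourier_coeff f (2 * m + 1) = 0))"
proof -
  \<comment> \<open>The midpoint of the interval from \<open>\<alpha> + 1 / 2\<close> to \<open>1\<close>.\<close>
  define \<theta> where "\<theta> = 3 / 4 + \<alpha> / 2"
  have \<theta>: "\<alpha> \<le> 1 / 2" "\<alpha> + 1 / 2 < \<theta>" "0 < \<theta>" "\<theta> < 1"
    using alpha by (auto simp: \<theta>_def)
  note odd = bessel_kernels_dominated_odd[OF \<theta>] and even = bessel_kernels_dominated_even[OF \<theta>]
  have "{m::nat. odd m} \<union> {m. even m} = UNIV" by auto
  then have all: "bessel_kernels_dominated \<alpha> \<theta> UNIV"
    using bessel_kernels_dominated_Un[OF odd even] by auto
  \<comment> \<open>The third function may only lose the odd indices from \<open>3\<close> on, so the index \<open>1\<close> is added to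
    the even ones.\<close>
  have even1: "bessel_kernels_dominated \<alpha> \<theta> ({m. even m} \<union> {1})"
    by (rule bessel_kernels_dominated_Un[OF even bessel_kernels_dominated_singleton]) (use \<theta> in auto)
  note majorant = bessel_fourier_majorant[OF a_lim _ \<theta>(4)]
  show ?thesis
  proof (intro conjI)
    show "\<exists>f :: real \<Rightarrow> real.
        set_integrable lebesgue {0..1} (\<lambda>x. sqrt x * f x) \<and>
        (\<forall>m\<ge>1. 0 \<le> a m \<and> a m \<le> bessel_fourier_coeff f m / bessel_J0_zero m powr \<alpha>) \<and>
        (\<lambda>m. bessel_fourier_coeff f m / bessel_J0_zero m powr \<alpha>) \<longlonglongrightarrow> 0"
      using majorant[OF all] a_nonneg by auto
  next
    have odd_class: "m \<in> {m. odd m}" if "\<nexists>k. k \<ge> 1 \<and> m = 2 * k" "m \<ge> 1" for m :: nat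
    proof (rule ccontr)
      assume "m \<notin> {m. odd m}"
      then obtain k where "m = 2 * k" by (auto elim!: evenE)
      moreover from this have "k \<ge> 1" using that(2) by linarith
      ultimately show False using that(1) by blast
    qed
    obtain f where f: "set_integrable lebesgue {0..1} (\<lambda>x. sqrt x * f x)"
      "\<And>m. m \<ge> 1 \<Longrightarrow> m \<in> {m. odd m} \<Longrightarrow> a m \<le> bessel_fourier_coeff f m / bessel_J0_zero m powr \<alpha>"
      "(\<lambda>m. bessel_fourier_coeff f m / bessel_J0_zero m powr \<alpha>) \<longlonglongrightarrow> 0"
      "\<And>m. m \<ge> 1 \<Longrightarrow> m \<notin> {m. odd m} \<Longrightarrow> bessel_fourier_coeff f m = 0"
      using majorant[OF odd] by blast
    show "\<exists>f :: real \<Rightarrow> real.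
        set_integrable lebesgue {0..1} (\<lambda>x. sqrt x * f x) \<and>
        (\<forall>m\<ge>1. (\<nexists>k. k \<ge> 1 \<and> m = 2 * k) \<longrightarrow>
           0 \<le> a m \<and> a m \<le> bessel_fourier_coeff f m / bessel_J0_zero m powr \<alpha>) \<and>
        (\<lambda>m. bessel_fourier_coeff f m / bessel_J0_zero m powr \<alpha>) \<longlonglongrightarrow> 0 \<and>
        (\<forall>m\<ge>1. bessel_fourier_coeff f (2 * m) = 0)"
    proof (intro exI[of _ f] conjI allI impI f(1,3))
      fix m :: nat assume "1 \<le> m"
      then show "bessel_fourier_coeff f (2 * m) = 0" by (intro f(4)) auto
    qed (use a_nonneg f(2) odd_class in blast)+
  next
    have even_class: "m \<in> {m. even m} \<union> {1}" if "\<nexists>k. k \<ge> 1 \<and> m = 2 * k + 1" for m :: nat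
    proof (rule ccontr)
      assume "m \<notin> {m. even m} \<union> {1}"
      then obtain k where "m = 2 * k + 1" "m \<noteq> 1" by (auto elim!: oddE)
      moreover from this have "k \<ge> 1" by linarith
      ultimately show False using that by blast
    qed
    obtain f where f: "set_integrable lebesgue {0..1} (\<lambda>x. sqrt x * f x)"
      "\<And>m. m \<ge> 1 \<Longrightarrow> m \<in> {m. even m} \<union> {1} \<Longrightarrow> a m \<le> bessel_fourier_coeff f m / bessel_J0_zero m powr \<alpha>"
      "(\<lambda>m. bessel_fourier_coeff f m / bessel_J0_zero m powr \<alpha>) \<longlonglongrightarrow> 0"
      "\<And>m. m \<ge> 1 \<Longrightarrow> m \<notin> {m. even m} \<union> {1} \<Longrightarrow> bessel_fourier_coeff f m = 0"
      using majorant[OF even1] by blast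
    show "\<exists>f :: real \<Rightarrow> real.
        set_integrable lebesgue {0..1} (\<lambda>x. sqrt x * f x) \<and>
        (\<forall>m\<ge>1. (\<nexists>k. k \<ge> 1 \<and> m = 2 * k + 1) \<longrightarrow>
           0 \<le> a m \<and> a m \<le> bessel_fourier_coeff f m / bessel_J0_zero m powr \<alpha>) \<and>
        (\<lambda>m. bessel_fourier_coeff f m / bessel_J0_zero m powr \<alpha>) \<longlonglongrightarrow> 0 \<and>
        (\<forall>m\<ge>1. bessel_fourier_coeff f (2 * m + 1) = 0)"
    proof (intro exI[of _ f] conjI allI impI f(1,3))
      fix m :: nat assume "1 \<le> m"
      then show "bessel_fourier_coeff f (2 * m + 1) = 0" by (intro f(4)) auto
    qed (use a_nonneg f(2) even_class in blast)+
  qed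
qed

end
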